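(* There exists a constant $C_*$ such that the following two statements hold. (1) Let $W_{\log}(\mathbf{x})=-\ln|\mathbf{x}|+\Omega(\theta)+|\mathbf{x}|^2$ on $\mathbb{R}^2$, where $\Omega:S^1\to\mathbb{R}$ is smooth, strictly positive, $\Omega(\theta+\pi)=\Omega(\theta)$, and $$\Omega(\theta)\ge\Omega(\tfrac{\pi}{2})+C_*\big|\theta-\tfrac{\pi}{2}\big|^2,\quad\forall\theta\in[0,\pi].$$ Then $\rho_{\mathrm{1D}}$ is the unique minimizer (up to translation) of the energy $E_{\log}$ associated to $W_{\log}$. (2) Let $\omega:S^1\to\mathbb{R}$ be smooth, nonnegative, not identically zero, with $\omega(\theta+\pi)=\omega(\theta)$ and $\omega(\frac{\pi}{2})=0$, and suppose that for some constant $c_\omega>0$ $$\omega(\theta)\ge c_\omega\big|\theta-\tfrac{\pi}{2}\big|^2,\quad\forall\theta\in[0,\pi].$$ For $\alpha\ge0$ let $E_{\log,\alpha}$ be the energy associated to $W_{\log,\alpha}(\mathbf{x})=-\ln|\mathbf{x}|+\alpha\omega(\theta)+|\mathbf{x}|^2$. Then there exists a unique $\alpha_*$ with $0<\alpha_*\le C_*/c_\omega$ (depending on $\omega$) such that for any $\alpha>\alpha_*$, $\rho_{\mathrm{1D}}$ is the unique minimizer of $E_{\log,\alpha}$ (up to translation), and for any $0\le\alpha<\alpha_*$, $\rho_{\mathrm{1D}}$ is not a minimizer of $E_{\log,\alpha}$.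
   Context: $S^1=[-\pi,\pi)$ is the set of angles (mod $2\pi$); $\theta$ is the angle of $\mathbf{x}\in\mathbb{R}^2\setminus\{0\}$, i.e. $\mathbf{x}/|\mathbf{x}|=(\cos\theta,\sin\theta)$. For an interaction potential $W$, its associated energy is $E[\rho]=\frac12\int_{\mathbb{R}^2}\int_{\mathbb{R}^2}W(\mathbf{x}-\mathbf{y})\rho(\mathbf{y})\,\mathrm{d}\mathbf{y}\,\rho(\mathbf{x})\,\mathrm{d}\mathbf{x}$ for probability measures $\rho$ on $\mathbb{R}^2$; minimizers are global minimizers among probability measures. Here $\rho_{\mathrm{1D}}(\mathbf{x})=\rho_1(x_2)\delta(x_1)$ with $\rho_1(x)=\frac{2}{\pi}(1-x^2)_+^{1/2}$, which is the unique energy minimizer (up to translation) for the one-dimensional interaction potential $-\ln|x|+|x|^2$. *)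

theory Defs
  imports "HOL-Probability.Probability"
begin

type_synonym plane = "real \<times> real"

definition angle :: "plane \<Rightarrow> real" where
  "angle x = (THE \<theta>. - pi \<le> \<theta> \<and> \<theta> < pi \<and> x /\<^sub>R norm x = (cos \<theta>, sin \<theta>))"

(* A smooth function on S^1 is represented by a C-infinity, 2 pi-periodic function on the line. *)
definition smooth_circle :: "(real \<Rightarrow> real) \<Rightarrow> bool" where
  "smooth_circle f \<longleftrightarrow>
     (\<forall>n x. (deriv ^^ n) f differentiable (at x)) \<and> (\<forall>\<theta>. f (\<theta> + 2 * pi) = f \<theta>)"

(* The value at the origin is the limit plus infinity; the library's ln 0 = 0 would be wrong here,
   since it would give atoms finite self-interaction energy. *)
definition W_log :: "(real \<Rightarrow> real) \<Rightarrow> plane \<Rightarrow> ereal" where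
  "W_log \<Omega> x = (if x = 0 then \<infinity> else ereal (- ln (norm x) + \<Omega> (angle x) + (norm x)\<^sup>2))"

definition prob_measures :: "plane measure set" where
  "prob_measures = {\<rho>. prob_space \<rho> \<and> sets \<rho> = sets borel}"

(* Integrals of the positive part minus the negative part. For W bounded below, the second term
   is finite, so this is the usual energy with values in (-infinity, infinity]. *)
definition energy :: "(plane \<Rightarrow> ereal) \<Rightarrow> plane measure \<Rightarrow> ereal" where
  "energy W \<rho> =
     (enn2ereal (\<integral>\<^sup>+x. (\<integral>\<^sup>+y. e2ennreal (W (x - y)) \<partial>\<rho>) \<partial>\<rho>)
      - enn2ereal (\<integral>\<^sup>+x. (\<integral>\<^sup>+y. e2ennreal (- W (x - y)) \<partial>\<rho>) \<partial>\<rho>)) / 2"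

definition is_minimizer :: "(plane \<Rightarrow> ereal) \<Rightarrow> plane measure \<Rightarrow> bool" where
  "is_minimizer W \<rho> \<longleftrightarrow>
     \<rho> \<in> prob_measures \<and> (\<forall>\<sigma>\<in>prob_measures. energy W \<rho> \<le> energy W \<sigma>)"

definition unique_minimizer_up_to_translation :: "(plane \<Rightarrow> ereal) \<Rightarrow> plane measure \<Rightarrow> bool" where
  "unique_minimizer_up_to_translation W \<rho> \<longleftrightarrow>
     is_minimizer W \<rho> \<and>
     (\<forall>\<sigma>. is_minimizer W \<sigma> \<longrightarrow> (\<exists>a. \<sigma> = distr \<rho> borel (\<lambda>x. x + a)))"

definition rho_1 :: "real \<Rightarrow> real" where
  "rho_1 x = 2 / pi * sqrt (max 0 (1 - x\<^sup>2))"

definition rho_1D :: "plane measure" where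
  "rho_1D = return borel 0 \<Otimes>\<^sub>M density lborel (\<lambda>x. ennreal (rho_1 x))"

end

theory Submission
  imports Defs
begin

text \<open>
  For real \<open>u\<close> let \<open>P\<^sub>u x = snd x + u * fst x\<close>. All these linear maps agree on the vertical axis, and
  they send \<^const>\<open>rho_1D\<close> to the semicircle law on the line. That law is the unique minimizer, up to
  translation, of the energy with interaction \<open>- ln \<bar>t\<bar> + t\<^sup>2\<close>. Hence, for every probability law of
  \<open>u\<close>, the measure \<^const>\<open>rho_1D\<close> minimizes the planar energy whose interaction is the average over \<open>u\<close>
  of \<open>- ln \<bar>P\<^sub>u x\<bar> + (P\<^sub>u x)\<^sup>2\<close>
  (\<open>rho_1D_minimizes_if_projection_bound\<close>). If \<open>u\<close> is centred, has variance at most \<open>1\<close>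
  and has a bounded density on a bounded interval, then this average is at most \<open>- ln \<bar>x\<bar> + C * (cos \<theta>)\<^sup>2 + \<bar>x\<bar>\<^sup>2\<close>, with equality on the
  vertical axis; here \<open>u\<close> is taken with the semicircle law itself
  (\<open>semicircle_average_log_quad_le\<close>). As \<open>\<bar>cos \<theta>\<bar> \<le> \<bar>\<theta> - pi / 2\<bar>\<close>, a potential
  for which \<open>\<Omega>\<close> grows at least like \<open>C * \<bar>\<theta> - pi / 2\<bar>\<^sup>2\<close> lies above it up to the constant
  \<open>\<Omega> (pi / 2)\<close>, and \<^const>\<open>rho_1D\<close> minimizes its energy.

  On the line, the interaction is convex on each half-line, so the energy is convex along monotone
  rearrangement: couple the semicircle law \<open>X\<close> with an arbitrary law \<open>Y\<close> through their quantile
  functions and apply the tangent inequality to each pair of points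
  (\<open>comonotone_log_energy_gap\<close>). The first-order term has the right sign because the Hilbert
  transform of the semicircle law is \<open>2 * x\<close>. The singular kernel \<open>1 / (x - y)\<close> is reached
  through a smoothing by Poisson kernels for which the corresponding integral is exactly a multiple of
  \<open>x\<close> (\<open>semicircle_smoothed_hilbert\<close>). The remainder in the tangent inequality is the variance of
  \<open>Y - X\<close>, up to a factor, and yields uniqueness.

  In the plane, uniqueness follows by adding to a potential for which \<^const>\<open>rho_1D\<close> is a minimizer an
  angular term that vanishes in the vertical direction only: a minimizer for the sum must be
  concentrated on a vertical line (\<open>unique_minimizer_of_added_anisotropy\<close>). In the first part of the
  theorem half of the growth is used for minimality and half for uniqueness, which makes \<open>2 * C\<close> the
  constant of the theorem. In the second part \<open>\<alpha>s\<close> is the infimum of all \<open>\<alpha> \<ge> 0\<close> for which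
  \<^const>\<open>rho_1D\<close> is a minimizer. It is positive because for \<open>\<alpha> = 0\<close> the equal mixture of
  \<^const>\<open>rho_1D\<close> with its rotation by a right angle has strictly smaller energy
  (\<open>cross_measure_better_isotropic\<close>), and a small \<open>\<alpha>\<close> cannot compensate for this.
\<close>

section \<open>The semicircle law\<close>

definition semicircle :: "real measure" where
  "semicircle = density lborel (\<lambda>x. ennreal (rho_1 x))"

lemma rho_1_nonneg: "0 \<le> rho_1 x"
  by (simp add: rho_1_def)

lemma borel_measurable_rho_1 [measurable]: "rho_1 \<in> borel_measurable borel"
  unfolding rho_1_def by measurable

lemma rho_1_eq_0: "1 \<le> \<bar>x\<bar> \<Longrightarrow> rho_1 x = 0"
  using abs_le_square_iff[of 1 x] by (simp add: rho_1_def max_def)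

lemma sets_semicircle [measurable_cong, simp]: "sets semicircle = sets borel"
  by (simp add: semicircle_def)

lemma space_semicircle [simp]: "space semicircle = UNIV"
  by (simp add: semicircle_def)

text \<open>In the angle \<open>b\<close> with \<open>x = - cos b\<close>, which increases from \<open>-1\<close> to \<open>1\<close> on \<open>[0, pi]\<close>, the
  semicircle law has density \<open>2 / pi * (sin b)\<^sup>2\<close>. Every integral below that can be computed in
  closed form becomes an integral of trigonometric functions, settled by an antiderivative.\<close>

lemma integral_semicircle_by_antiderivative:
  fixes \<phi> F :: "real \<Rightarrow> real"
  assumes [measurable]: "\<phi> \<in> borel_measurable borel"
    and cont: "continuous_on {-1..1} \<phi>"
    and F: "\<And>b. 0 \<le> b \<Longrightarrow> b \<le> pi \<Longrightarrow>
              (F has_real_derivative 2 / pi * (sin b)\<^sup>2 * \<phi> (- cos b)) (at b)"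
  shows "integrable semicircle \<phi>" "(\<integral>x. \<phi> x \<partial>semicircle) = F pi - F 0"
proof -
  define f where "f x = rho_1 x * \<phi> x" for x
  have cont_rho: "continuous_on {-1..1} rho_1"
    unfolding rho_1_def by (intro continuous_intros)
  have int_f: "set_integrable lborel {-1..1} f"
    unfolding f_def by (intro borel_integrable_atLeastAtMost' continuous_on_mult cont_rho cont)
  have f_ind: "indicator {-1..1} x *\<^sub>R f x = f x" for x
    using rho_1_eq_0[of x] by (cases "\<bar>x\<bar> \<le> 1") (auto simp: f_def indicator_def)
  have "integrable lborel f"
    using int_f unfolding set_integrable_def by (simp only: f_ind)
  then show "integrable semicircle \<phi>"
    unfolding semicircle_def f_def
    by (subst integrable_density) (auto simp: rho_1_nonneg)
  have deriv: "((\<lambda>b. - cos b) has_real_derivative sin b) (at b)" for b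
    by (auto intro!: derivative_eq_intros)
  have pull: "f (- cos b) * sin b = 2 / pi * (sin b)\<^sup>2 * \<phi> (- cos b)"
    if "0 \<le> b" "b \<le> pi" for b
  proof -
    have "rho_1 (- cos b) = 2 / pi * sin b"
      using sin_ge_zero[OF that] by (simp add: rho_1_def sin_squared_eq[symmetric])
    then show ?thesis
      by (simp add: f_def power2_eq_square)
  qed
  have cont_int: "continuous_on {0..pi} (\<lambda>b. 2 / pi * (sin b)\<^sup>2 * \<phi> (- cos b))"
    by (intro continuous_intros continuous_on_compose2[OF cont]) auto
  have "(\<integral>x. \<phi> x \<partial>semicircle) = (LBINT x. f x)"
    unfolding semicircle_def f_def
    by (subst integral_density) (auto simp: rho_1_nonneg)
  also have "\<dots> = (LBINT x. f x * indicator {- cos 0..- cos pi} x)"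
    using f_ind by (intro Bochner_Integration.integral_cong) (auto simp: mult.commute)
  also have "\<dots> = (LBINT b. f (- cos b) * sin b * indicator {0..pi} b)"
    using int_f by (intro integral_substitution deriv continuous_intros) (auto intro: sin_ge_zero)
  also have "\<dots> = (LBINT b. 2 / pi * (sin b)\<^sup>2 * \<phi> (- cos b) * indicator {0..pi} b)"
    using pull by (intro Bochner_Integration.integral_cong) (auto simp: indicator_def)
  also have "\<dots> = F pi - F 0"
    using integral_FTC_Icc[OF _ _ cont_int, of F] F
    by (auto simp: has_real_derivative_iff_has_vector_derivative[symmetric] mult.commute
             intro: DERIV_subset)
  finally show "(\<integral>x. \<phi> x \<partial>semicircle) = F pi - F 0" .
qed

lemma semicircle_total: "(\<integral>x. (1::real) \<partial>semicircle) = 1"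
  and semicircle_mean: "integrable semicircle (\<lambda>x. x)" "(\<integral>x. x \<partial>semicircle) = 0"
  and semicircle_second_moment: "integrable semicircle (\<lambda>x. x\<^sup>2)"
    "(\<integral>x. x\<^sup>2 \<partial>semicircle) = 1 / 4"
proof -
  have "((\<lambda>b. b - sin b * cos b) has_real_derivative 2 * (sin b)\<^sup>2) (at b)" for b :: real
    by (rule derivative_eq_intros refl)+
       (use sin_cos_squared_add[of b] in \<open>simp add: power2_eq_square\<close>)
  from DERIV_cmult[OF this, of "1 / pi"]
  have "((\<lambda>b. (b - sin b * cos b) / pi) has_real_derivative 2 / pi * (sin b)\<^sup>2 * 1) (at b)" for b
    by simp
  note total = integral_semicircle_by_antiderivative(2)[where \<phi> = "\<lambda>x. 1", OF _ _ this]
  show "(\<integral>x. (1::real) \<partial>semicircle) = 1"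
    by (subst total) auto
  have "((\<lambda>b. sin b ^ 3) has_real_derivative 3 * (sin b)\<^sup>2 * cos b) (at b)" for b :: real
    by (auto intro!: derivative_eq_intros)
  from DERIV_cmult[OF this, of "- 2 / (3 * pi)"]
  have "((\<lambda>b. - 2 / (3 * pi) * sin b ^ 3) has_real_derivative
          2 / pi * (sin b)\<^sup>2 * (- cos b)) (at b)" for b
    by (simp add: mult_ac)
  note mean = integral_semicircle_by_antiderivative[where \<phi> = "\<lambda>x. x", OF _ _ this]
  show "integrable semicircle (\<lambda>x. x)"
    by (rule mean(1)) auto
  show "(\<integral>x. x \<partial>semicircle) = 0"
    by (subst mean(2)) auto
  have "((\<lambda>b. b - sin b * cos b + 2 * (sin b ^ 3 * cos b)) has_real_derivative
          8 * ((sin b)\<^sup>2 * (cos b)\<^sup>2)) (at b)" for b :: real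
  proof -
    have trig: "(cos b)\<^sup>2 = 1 - (sin b)\<^sup>2"
      by (simp add: cos_squared_eq)
    have "((\<lambda>b. b - sin b * cos b + 2 * (sin b ^ 3 * cos b)) has_real_derivative
        1 - (cos b * cos b - sin b * sin b)
        + 2 * (3 * (sin b)\<^sup>2 * cos b * cos b - sin b ^ 3 * sin b)) (at b)"
      by (auto intro!: derivative_eq_intros)
    also have "1 - (cos b * cos b - sin b * sin b)
        + 2 * (3 * (sin b)\<^sup>2 * cos b * cos b - sin b ^ 3 * sin b) = 8 * ((sin b)\<^sup>2 * (cos b)\<^sup>2)"
      using trig by algebra
    finally show ?thesis .
  qed
  from DERIV_cmult[OF this, of "1 / (4 * pi)"]
  have "((\<lambda>b. (b - sin b * cos b + 2 * (sin b ^ 3 * cos b)) / (4 * pi)) has_real_derivative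
          2 / pi * (sin b)\<^sup>2 * (- cos b)\<^sup>2) (at b)" for b
    by (simp add: mult_ac)
  note sq = integral_semicircle_by_antiderivative[where \<phi> = "\<lambda>x. x\<^sup>2", OF _ _ this]
  show "integrable semicircle (\<lambda>x. x\<^sup>2)"
    by (rule sq(1)) (auto intro!: continuous_intros)
  show "(\<integral>x. x\<^sup>2 \<partial>semicircle) = 1 / 4"
    by (subst sq(2)) (auto intro!: continuous_intros)
qed

lemma prob_space_semicircle: "prob_space semicircle"
proof
  show "emeasure semicircle (space semicircle) = 1"
    using semicircle_total
    by (cases "emeasure semicircle UNIV") (auto simp: measure_def)
qed

section \<open>The smoothed Hilbert transform of the semicircle law\<close>

text \<open>The denominator \<open>\<bar>1 - r * exp (\<i> * u)\<bar>\<^sup>2\<close> of the Poisson kernel of the unit disc.\<close>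

definition poisson_denom :: "real \<Rightarrow> real \<Rightarrow> real" where
  "poisson_denom r u = 1 - 2 * r * cos u + r\<^sup>2"

lemma poisson_denom_pos: "0 < r \<Longrightarrow> r < 1 \<Longrightarrow> 0 < poisson_denom r u"
proof -
  assume r: "0 < r" "r < 1"
  have "0 < (1 - r)\<^sup>2"
    using r by simp
  also have "\<dots> \<le> poisson_denom r u"
    using mult_left_mono[OF cos_le_one[of u], of "2 * r"] r
    by (simp add: poisson_denom_def power2_diff)
  finally show ?thesis .
qed

text \<open>A strictly positive substitute for \<open>(x - y)\<^sup>2\<close>: at \<open>r = 1\<close> it equals \<open>4 * (x - y)\<^sup>2\<close>. It is
  \<open>exp (- 2 * L)\<close> for the Abel means
  \<open>L = (\<Sum>n\<ge>1. 2 * r ^ n / n * cos (n * a) * cos (n * b))\<close> of the Fourier series of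
  \<open>- ln (2 * \<bar>x - y\<bar>)\<close> at \<open>x = cos a\<close>, \<open>y = cos b\<close>. This choice, rather than
  \<open>(x - y)\<^sup>2 + \<epsilon>\<^sup>2\<close>, makes the smoothed Hilbert transform of the semicircle law exactly linear.\<close>

definition smoothed_gap_sq :: "real \<Rightarrow> real \<Rightarrow> real \<Rightarrow> real" where
  "smoothed_gap_sq r x y = 4 * r\<^sup>2 * (x - y)\<^sup>2 + (1 - r)\<^sup>2 * ((1 + r)\<^sup>2 - 4 * r * x * y)"

text \<open>The factorization splits the reciprocal into Poisson kernels centred at \<open>a\<close> and \<open>- a\<close>.\<close>

lemma smoothed_gap_sq_eq:
  "smoothed_gap_sq r (- cos a) (- cos b) = poisson_denom r (b - a) * poisson_denom r (b + a)"
proof -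
  have "(sin a)\<^sup>2 = 1 - (cos a)\<^sup>2" "(sin b)\<^sup>2 = 1 - (cos b)\<^sup>2"
    by (simp_all add: sin_squared_eq)
  then show ?thesis
    unfolding smoothed_gap_sq_def poisson_denom_def cos_add cos_diff by algebra
qed

text \<open>This function is \<open>- Arg (1 - r * exp (\<i> * u))\<close>, the conjugate of \<open>- ln (poisson_denom r u) / 2\<close>.
  It gives a periodic antiderivative, up to a linear term, of the Poisson kernel:
  \<open>(1 - r\<^sup>2) / poisson_denom r u = 1 + 2 * (r * cos u - r\<^sup>2) / poisson_denom r u\<close>.\<close>

lemma DERIV_conjugate_poisson:
  assumes r: "0 < r" "r < 1"
  shows "((\<lambda>u. arctan (r * sin u / (1 - r * cos u))) has_real_derivative
           (r * cos u - r\<^sup>2) / poisson_denom r u) (at u)"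
proof -
  have "r * cos u \<le> r * 1"
    using r by (intro mult_left_mono) auto
  then have pos: "0 < 1 - r * cos u"
    using r by linarith
  have sc: "(sin u)\<^sup>2 = 1 - (cos u)\<^sup>2"
    by (rule sin_squared_eq)
  have D: "(1 - r * cos u)\<^sup>2 + (r * sin u)\<^sup>2 = poisson_denom r u"
    unfolding poisson_denom_def using sc by algebra
  have "(1 - r * cos u)\<^sup>2 * (1 + (r * sin u / (1 - r * cos u))\<^sup>2) = poisson_denom r u"
    unfolding D[symmetric] using pos by (simp add: power_divide distrib_left)
  then have "1 + (r * sin u / (1 - r * cos u))\<^sup>2 = poisson_denom r u / (1 - r * cos u)\<^sup>2"
    using pos by (subst nonzero_eq_divide_eq) (simp_all add: mult.commute)
  then have inv: "inverse (1 + (r * sin u / (1 - r * cos u))\<^sup>2) =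
      (1 - r * cos u)\<^sup>2 / poisson_denom r u"
    by simp
  have num: "r * cos u * (1 - r * cos u) - r * sin u * (r * sin u) = r * cos u - r\<^sup>2"
    using sc by algebra
  have "((\<lambda>u. r * sin u / (1 - r * cos u)) has_real_derivative
      (r * cos u - r\<^sup>2) / (1 - r * cos u)\<^sup>2) (at u)"
    using pos unfolding num[symmetric]
    by (auto intro!: derivative_eq_intros simp: power2_eq_square)
  from DERIV_chain2[OF DERIV_arctan this] show ?thesis
    using pos by (simp add: inv)
qed

text \<open>With \<open>x = - cos a\<close> and \<open>y = - cos b\<close>, partial fractions turn the integrand into
  \<open>\<phi> b + \<phi> (- b)\<close> for \<open>\<phi> b = sin b * (cos b - cos a) / poisson_denom r (b - a)\<close>, up to a constant
  factor. An antiderivative \<open>G\<close> of \<open>\<phi>\<close> is a periodic function plus a multiple of \<open>b\<close>, so that only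
  this multiple contributes to \<open>G pi - G (- pi)\<close>.\<close>

lemma semicircle_smoothed_hilbert:
  assumes r: "0 < r" "r < 1" and x: "\<bar>x\<bar> < 1"
  shows "(\<integral>y. (x - y) / smoothed_gap_sq r x y \<partial>semicircle) = x / (1 + r)"
proof -
  define a where "a = arccos (- x)"
  have x_eq: "x = - cos a"
    using x by (simp add: a_def)
  have "0 < a" "a < pi"
    unfolding a_def using arccos_lt_bounded[of "- x"] x by auto
  then have sin_a: "0 < sin a"
    by (rule sin_gt_zero)
  define D where "D = poisson_denom r"
  have D_pos: "0 < D u" for u
    unfolding D_def by (rule poisson_denom_pos[OF r])
  define c where "c = cos a"
  \<comment> \<open>The root of \<open>poisson_denom r u\<close> as a polynomial in \<open>cos u\<close> is \<open>cos u = \<kappa>\<close>; \<open>G\<close> comes from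
    dividing the numerator of \<open>\<phi>\<close>, written in \<open>u = b - a\<close>, by \<open>\<kappa> - cos u\<close> with remainder.\<close>
  define A where "A = sin a * cos a"
  define \<kappa> where "\<kappa> = (1 + r\<^sup>2) / (2 * r)"
  have \<kappa>_r: "2 * r * \<kappa> = 1 + r\<^sup>2"
    using r by (simp add: \<kappa>_def)
  define Q where "Q u = arctan (r * sin u / (1 - r * cos u))" for u
  define G where "G b =
      (A * ((2 * \<kappa>\<^sup>2 - \<kappa> - 1) / (1 - r\<^sup>2) * (b - a + 2 * Q (b - a))
           - (2 * sin (b - a) + (2 * \<kappa> - 1) * (b - a)) / (2 * r)))
      + (2 * c\<^sup>2 - 1) / (2 * r) * cos (b - a)
      + ((2 * c\<^sup>2 - 1) * \<kappa> - c\<^sup>2) / (2 * r) * ln (D (b - a))" for b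
  have DERIV_G: "(G has_real_derivative sin b * (cos b - cos a) / D (b - a)) (at b)" for b
  proof -
    define u where "u = b - a"
    have dlin: "((\<lambda>b. b - a) has_real_derivative 1) (at b)"
      by (auto intro!: derivative_eq_intros)
    have dQ: "((\<lambda>b. Q (b - a)) has_real_derivative (r * cos u - r\<^sup>2) / D u) (at b)"
      using DERIV_chain2[OF DERIV_conjugate_poisson[OF r] dlin]
      by (simp add: Q_def D_def u_def)
    have dD: "((\<lambda>b. D (b - a)) has_real_derivative 2 * r * sin u) (at b)"
      unfolding D_def poisson_denom_def u_def by (auto intro!: derivative_eq_intros)
    have dln: "((\<lambda>b. ln (D (b - a))) has_real_derivative 2 * r * sin u / D u) (at b)"
      using DERIV_chain2[OF DERIV_ln_divide[OF D_pos] dD] by (simp add: u_def)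
    have dsin: "((\<lambda>b. sin (b - a)) has_real_derivative cos u) (at b)"
      and dcos: "((\<lambda>b. cos (b - a)) has_real_derivative - sin u) (at b)"
      unfolding u_def by (auto intro!: derivative_eq_intros)
    have "(G has_real_derivative
        A * ((2 * \<kappa>\<^sup>2 - \<kappa> - 1) / (1 - r\<^sup>2) * (1 + 2 * ((r * cos u - r\<^sup>2) / D u))
           - (2 * cos u + (2 * \<kappa> - 1) * 1) / (2 * r))
        + (2 * c\<^sup>2 - 1) / (2 * r) * (- sin u)
        + ((2 * c\<^sup>2 - 1) * \<kappa> - c\<^sup>2) / (2 * r) * (2 * r * sin u / D u)) (at b)"
      unfolding G_def
      by (intro DERIV_add DERIV_diff DERIV_cmult DERIV_cdivide dlin dQ dsin dcos dln)
    also have "1 + 2 * ((r * cos u - r\<^sup>2) / D u) = (1 - r\<^sup>2) / D u"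
      using D_pos[of u] by (simp add: field_simps) (simp add: D_def poisson_denom_def)
    also have "(2 * \<kappa>\<^sup>2 - \<kappa> - 1) / (1 - r\<^sup>2) * ((1 - r\<^sup>2) / D u) = (2 * \<kappa>\<^sup>2 - \<kappa> - 1) / D u"
      using r by (simp add: power2_eq_1_iff)
    also have "((2 * c\<^sup>2 - 1) * \<kappa> - c\<^sup>2) / (2 * r) * (2 * r * sin u / D u) =
        ((2 * c\<^sup>2 - 1) * \<kappa> - c\<^sup>2) * sin u / D u"
      using r by simp
    also have "A * ((2 * \<kappa>\<^sup>2 - \<kappa> - 1) / D u - (2 * cos u + (2 * \<kappa> - 1) * 1) / (2 * r))
        + (2 * c\<^sup>2 - 1) / (2 * r) * (- sin u) + ((2 * c\<^sup>2 - 1) * \<kappa> - c\<^sup>2) * sin u / D u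
      = (A * (2 * (cos u)\<^sup>2 - cos u - 1) + sin u * ((2 * c\<^sup>2 - 1) * cos u - c\<^sup>2)) / D u"
    proof -
      define e where "e = \<kappa> - cos u"
      have \<kappa>: "\<kappa> = cos u + e"
        by (simp add: e_def)
      have D_u: "D u = 2 * r * e"
        unfolding D_def poisson_denom_def e_def using \<kappa>_r by (simp add: right_diff_distrib)
      have "e \<noteq> 0"
        using D_u D_pos[of u] by auto
      then show ?thesis
        unfolding D_u \<kappa> using r by (simp add: divide_simps) algebra
    qed
    also have "A * (2 * (cos u)\<^sup>2 - cos u - 1) + sin u * ((2 * c\<^sup>2 - 1) * cos u - c\<^sup>2) =
        sin b * (cos b - cos a)"
    proof -
      have "b = a + u"
        by (simp add: u_def)
      moreover have "(sin u)\<^sup>2 = 1 - (cos u)\<^sup>2" "(sin a)\<^sup>2 = 1 - (cos a)\<^sup>2"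
        by (simp_all add: sin_squared_eq)
      ultimately show ?thesis
        unfolding A_def c_def by (simp only: sin_add cos_add) algebra
    qed
    finally show ?thesis
      by (simp add: u_def)
  qed
  have diff_divide: "n / p - n / q = n * (q - p) / (p * q)" if "p \<noteq> 0" "q \<noteq> 0" for n p q :: real
    using that by (simp add: field_simps)
  define F where "F b = (G b - G (- b)) / (2 * pi * r * sin a)" for b
  have DERIV_F: "(F has_real_derivative
      2 / pi * (sin b)\<^sup>2 * ((x - - cos b) / smoothed_gap_sq r x (- cos b))) (at b)" for b
  proof -
    have "((\<lambda>b. G (- b)) has_real_derivative
        sin (- b) * (cos (- b) - cos a) / D (- b - a) * (- 1)) (at b)"
      by (rule DERIV_chain2[OF DERIV_G]) (auto intro!: derivative_eq_intros)
    moreover have "D (- b - a) = D (b + a)"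
      using cos_minus[of "b + a"] unfolding D_def poisson_denom_def by simp
    ultimately have "(F has_real_derivative
        (sin b * (cos b - cos a) / D (b - a) - sin b * (cos b - cos a) / D (b + a)) /
          (2 * pi * r * sin a)) (at b)"
      unfolding F_def using DERIV_G[of b]
      by (intro DERIV_cdivide DERIV_diff) auto
    moreover have "(sin b * (cos b - cos a) / D (b - a) - sin b * (cos b - cos a) / D (b + a)) /
        (2 * pi * r * sin a) = 2 / pi * (sin b)\<^sup>2 * ((x - - cos b) / (D (b - a) * D (b + a)))"
    proof -
      have "D (b + a) - D (b - a) = 4 * r * sin a * sin b"
        by (simp add: D_def poisson_denom_def cos_add cos_diff algebra_simps)
      then have "sin b * (cos b - cos a) / D (b - a) - sin b * (cos b - cos a) / D (b + a)
          = sin b * (cos b - cos a) * (4 * r * sin a * sin b) / (D (b - a) * D (b + a))"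
        using diff_divide[of "D (b - a)" "D (b + a)" "sin b * (cos b - cos a)"]
          D_pos[of "b - a"] D_pos[of "b + a"] by simp
      then show ?thesis
        using r sin_a by (simp add: x_eq power2_eq_square)
    qed
    ultimately show ?thesis
      by (simp add: x_eq smoothed_gap_sq_eq D_def)
  qed
  have gap_pos: "0 < smoothed_gap_sq r x y" if "\<bar>y\<bar> \<le> 1" for y
    using smoothed_gap_sq_eq[of r a "arccos (- y)"] that D_pos
    by (simp add: x_eq cos_arccos_abs D_def)
  have "(\<integral>y. (x - y) / smoothed_gap_sq r x y \<partial>semicircle) = F pi - F 0"
  proof (rule integral_semicircle_by_antiderivative(2))
    show "(\<lambda>y. (x - y) / smoothed_gap_sq r x y) \<in> borel_measurable borel"
      unfolding smoothed_gap_sq_def by measurable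
    have "smoothed_gap_sq r x y \<noteq> 0" if "y \<in> {-1..1}" for y
      using gap_pos[of y] that by (auto simp: abs_le_iff)
    then show "continuous_on {-1..1} (\<lambda>y. (x - y) / smoothed_gap_sq r x y)"
      unfolding smoothed_gap_sq_def by (intro continuous_intros) auto
  qed (rule DERIV_F)
  also have "\<dots> = x / (1 + r)"
  proof -
    \<comment> \<open>The periodic terms of \<open>G\<close> cancel between \<open>pi\<close> and \<open>- pi\<close>.\<close>
    have per: "sin (- pi - a) = sin (pi - a)" "cos (- pi - a) = cos (pi - a)"
      using sin_periodic[of "- pi - a"] cos_periodic[of "- pi - a"] by (simp_all del: sin_periodic cos_periodic)
    have "G pi - G (- pi) =
        2 * pi * A * ((2 * \<kappa>\<^sup>2 - \<kappa> - 1) / (1 - r\<^sup>2) - (2 * \<kappa> - 1) / (2 * r))"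
      unfolding G_def Q_def D_def poisson_denom_def per
      by (simp add: algebra_simps add_divide_distrib diff_divide_distrib)
    also have "(2 * \<kappa>\<^sup>2 - \<kappa> - 1) / (1 - r\<^sup>2) - (2 * \<kappa> - 1) / (2 * r) = - r / (1 + r)"
    proof -
      have "(2 * \<kappa>\<^sup>2 - \<kappa> - 1) = (1 - r) * ((1 - r) * (1 + r + r\<^sup>2) / (2 * r\<^sup>2))"
        unfolding \<kappa>_def using r by (simp add: divide_simps) algebra
      moreover have "1 - r\<^sup>2 = (1 - r) * (1 + r)"
        by algebra
      ultimately have "(2 * \<kappa>\<^sup>2 - \<kappa> - 1) / (1 - r\<^sup>2) = (1 - r) * (1 + r + r\<^sup>2) / (2 * r\<^sup>2) / (1 + r)"
        using r by simp
      moreover have "(2 * \<kappa> - 1) / (2 * r) = (1 - r + r\<^sup>2) / (2 * r\<^sup>2)"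
        unfolding \<kappa>_def using r by (simp add: divide_simps power2_eq_square)
      moreover have "(1 - r) * (1 + r + r\<^sup>2) / (2 * r\<^sup>2) / (1 + r) - (1 - r + r\<^sup>2) / (2 * r\<^sup>2) = - r / (1 + r)"
        using r by (simp add: divide_simps) algebra
      ultimately show ?thesis
        by simp
    qed
    finally have "F pi = - cos a / (1 + r)"
      using r sin_a by (simp add: F_def A_def)
    then show ?thesis
      by (simp add: F_def x_eq)
  qed
  finally show ?thesis .
qed

text \<open>The factor \<open>r * (1 + r)\<^sup>2\<close> tends to \<open>4\<close>, which normalizes the limit to \<open>1 / (x - y)\<close>.\<close>

definition smoothed_hilbert :: "real \<Rightarrow> real \<Rightarrow> real \<Rightarrow> real" where
  "smoothed_hilbert r x y = r * (1 + r)\<^sup>2 * ((x - y) / smoothed_gap_sq r x y)"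

lemma borel_measurable_smoothed_hilbert [measurable]:
  "(\<lambda>z. smoothed_hilbert r (f z) (g z)) \<in> borel_measurable M"
  if [measurable]: "f \<in> borel_measurable M" "g \<in> borel_measurable M"
  unfolding smoothed_hilbert_def smoothed_gap_sq_def by measurable

lemma smoothed_gap_sq_lower:
  assumes "0 < r" "r < 1" "\<bar>x\<bar> < 1" "\<bar>y\<bar> < 1"
  shows "(1 - r) ^ 4 \<le> smoothed_gap_sq r x y"
proof -
  have "\<bar>x\<bar> * \<bar>y\<bar> \<le> 1 * 1"
    using assms by (intro mult_mono) auto
  then have "r * (x * y) \<le> r * 1"
    using assms by (intro mult_left_mono) (auto simp flip: abs_mult)
  then have "(1 - r)\<^sup>2 * (1 - r)\<^sup>2 \<le> (1 - r)\<^sup>2 * ((1 + r)\<^sup>2 - 4 * r * x * y)"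
    by (intro mult_left_mono zero_le_power2) (simp add: power2_eq_square algebra_simps)
  moreover have "0 \<le> 4 * r\<^sup>2 * (x - y)\<^sup>2"
    by simp
  moreover have "(1 - r) ^ 4 = (1 - r)\<^sup>2 * (1 - r)\<^sup>2"
    by (simp flip: power_add)
  ultimately show ?thesis
    unfolding smoothed_gap_sq_def by linarith
qed

lemma smoothed_hilbert_swap: "smoothed_hilbert r x y = - smoothed_hilbert r y x"
proof -
  have "smoothed_gap_sq r y x = smoothed_gap_sq r x y"
    by (simp add: smoothed_gap_sq_def power2_commute mult_ac)
  then show ?thesis
    by (simp add: smoothed_hilbert_def right_diff_distrib diff_divide_distrib)
qed

lemma smoothed_hilbert_bound:
  assumes "0 < r" "r < 1" "\<bar>x\<bar> < 1" "\<bar>y\<bar> < 1"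
  shows "\<bar>smoothed_hilbert r x y\<bar> \<le> 8 / (1 - r) ^ 4"
proof -
  have "0 < (1 - r) ^ 4"
    using assms by simp
  moreover have "(1 - r) ^ 4 \<le> smoothed_gap_sq r x y"
    using assms by (rule smoothed_gap_sq_lower)
  moreover have "\<bar>x - y\<bar> \<le> 2"
    using assms by linarith
  ultimately have "\<bar>(x - y) / smoothed_gap_sq r x y\<bar> \<le> 2 / (1 - r) ^ 4"
    by (auto simp: abs_divide intro!: frac_le)
  moreover have "r * (1 + r)\<^sup>2 \<le> 1 * 2\<^sup>2"
    using assms by (intro mult_mono power_mono) auto
  ultimately have "r * (1 + r)\<^sup>2 * \<bar>(x - y) / smoothed_gap_sq r x y\<bar> \<le> 4 * (2 / (1 - r) ^ 4)"
    using assms by (intro mult_mono) auto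
  then show ?thesis
    using assms by (simp add: smoothed_hilbert_def abs_mult)
qed

lemma smoothed_hilbert_sign:
  assumes "0 < r" "r < 1" "\<bar>x\<bar> < 1" "\<bar>y\<bar> < 1" "0 \<le> (x - y) * d"
  shows "0 \<le> d * smoothed_hilbert r x y"
proof -
  have "0 < (1 - r) ^ 4"
    using assms by simp
  also have "(1 - r) ^ 4 \<le> smoothed_gap_sq r x y"
    using assms by (intro smoothed_gap_sq_lower)
  finally have "0 \<le> r * (1 + r)\<^sup>2 * (((x - y) * d) / smoothed_gap_sq r x y)"
    using assms by (intro mult_nonneg_nonneg divide_nonneg_pos assms(5)) auto
  then show ?thesis
    by (simp add: smoothed_hilbert_def mult_ac)
qed

lemma smoothed_hilbert_tendsto:
  assumes "x \<noteq> y"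
  shows "((\<lambda>r. smoothed_hilbert r x y) \<longlongrightarrow> 1 / (x - y)) (at 1)"
proof -
  have "((\<lambda>r. smoothed_hilbert r x y) \<longlongrightarrow>
      1 * (1 + 1)\<^sup>2 * ((x - y) / smoothed_gap_sq 1 x y)) (at 1)"
    unfolding smoothed_hilbert_def smoothed_gap_sq_def
    using assms by (intro tendsto_intros) auto
  also have "1 * (1 + 1)\<^sup>2 * ((x - y) / smoothed_gap_sq 1 x y) = 1 / (x - y)"
    using assms by (simp add: smoothed_gap_sq_def power2_eq_square divide_simps)
  finally show ?thesis .
qed

text \<open>As \<open>r\<close> tends to \<open>1\<close> this becomes the Euler--Lagrange equation of the semicircle law: its Hilbert
  transform is \<open>2 * x\<close> on the support, which balances the force of the quadratic confinement.\<close>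

lemma smoothed_hilbert_integral:
  assumes "0 < r" "r < 1" "\<bar>x\<bar> < 1"
  shows "(\<integral>y. smoothed_hilbert r x y \<partial>semicircle) = r * (1 + r) * x"
proof -
  have "(\<integral>y. smoothed_hilbert r x y \<partial>semicircle) =
      r * (1 + r)\<^sup>2 * (\<integral>y. (x - y) / smoothed_gap_sq r x y \<partial>semicircle)"
    unfolding smoothed_hilbert_def by (rule integral_mult_right_zero)
  then show ?thesis
    using assms by (simp add: semicircle_smoothed_hilbert power2_eq_square)
qed

section \<open>The logarithmic energy on the line\<close>

text \<open>The one-dimensional interaction \<open>- ln \<bar>t\<bar> + t\<^sup>2\<close>. It is positive, so that all energies below are
  integrals of nonnegative functions, with values in \<^typ>\<open>ennreal\<close>.\<close>

definition log_quad :: "real \<Rightarrow> ennreal" where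
  "log_quad t = (if t = 0 then \<infinity> else ennreal (t\<^sup>2 - ln \<bar>t\<bar>))"

lemma borel_measurable_log_quad [measurable]: "log_quad \<in> borel_measurable borel"
  unfolding log_quad_def by measurable

lemma log_quad_lower: "t \<noteq> 0 \<Longrightarrow> t\<^sup>2 / 2 \<le> t\<^sup>2 - ln \<bar>t\<bar>" for t :: real
proof -
  assume "t \<noteq> 0"
  then have "2 * ln \<bar>t\<bar> = ln (t\<^sup>2)"
    using ln_realpow[of "\<bar>t\<bar>" 2] by simp
  also have "\<dots> \<le> t\<^sup>2 - 1"
    using \<open>t \<noteq> 0\<close> by (intro ln_le_minus_one) simp
  finally show ?thesis
    by simp
qed

lemma log_quad_nonneg: "t \<noteq> 0 \<Longrightarrow> 0 \<le> t\<^sup>2 - ln \<bar>t\<bar>" for t :: real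
  using log_quad_lower[of t] zero_le_power2[of t] by linarith

lemma half_square_le_log_quad: "ennreal (t\<^sup>2 / 2) \<le> log_quad t"
  using log_quad_lower[of t] by (simp add: log_quad_def ennreal_leI)

text \<open>The tangent inequality at \<open>a\<close> for \<open>t\<^sup>2 - ln t\<close>, convex on each half-line, with the quadratic
  part kept exact. The hypothesis \<open>0 \<le> a * b\<close> puts \<open>a\<close> and \<open>b\<close> on the same half-line.\<close>

lemma log_quad_convex:
  fixes a b :: real
  assumes "a \<noteq> 0" "b \<noteq> 0" "0 \<le> a * b"
  shows "a\<^sup>2 - ln \<bar>a\<bar> + (b - a)\<^sup>2 \<le> b\<^sup>2 - ln \<bar>b\<bar> - 1 + b / a - 2 * (a * b) + 2 * a\<^sup>2"
proof -
  have pos: "0 < b / a"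
    using assms by (auto simp: zero_less_divide_iff zero_le_mult_iff)
  then have "ln (b / a) \<le> b / a - 1"
    by (rule ln_le_minus_one)
  moreover have "ln (b / a) = ln \<bar>b\<bar> - ln \<bar>a\<bar>"
    using assms pos by (metis abs_divide abs_of_pos ln_div zero_less_abs_iff)
  ultimately show ?thesis
    by (simp add: power2_diff)
qed

text \<open>The quadratic part of the interaction confines: for some fixed \<open>p\<close> the average over \<open>q\<close> of
  \<open>(Y p - Y q)\<^sup>2 / 2\<close> is finite.\<close>

lemma (in prob_space) square_integrable_of_finite_log_energy:
  assumes [measurable]: "Y \<in> borel_measurable M"
    and fin: "(\<integral>\<^sup>+z. log_quad (Y (fst z) - Y (snd z)) \<partial>(M \<Otimes>\<^sub>M M)) \<noteq> \<infinity>"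
  shows "integrable M Y" "integrable M (\<lambda>p. (Y p)\<^sup>2)"
proof -
  have "(\<integral>\<^sup>+p. (\<integral>\<^sup>+q. log_quad (Y p - Y q) \<partial>M) \<partial>M) \<noteq> \<infinity>"
    using fin nn_integral_fst[of "\<lambda>z. log_quad (Y (fst z) - Y (snd z))" M] by simp
  then have "AE p in M. (\<integral>\<^sup>+q. log_quad (Y p - Y q) \<partial>M) \<noteq> \<infinity>"
    by (intro nn_integral_PInf_AE) auto
  then obtain p where p: "(\<integral>\<^sup>+q. log_quad (Y p - Y q) \<partial>M) \<noteq> \<infinity>"
    using AE_contr by blast
  have "(\<integral>\<^sup>+q. ennreal ((Y p - Y q)\<^sup>2 / 2) \<partial>M) \<le> (\<integral>\<^sup>+q. log_quad (Y p - Y q) \<partial>M)"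
    by (intro nn_integral_mono half_square_le_log_quad)
  then have int: "integrable M (\<lambda>q. (Y p - Y q)\<^sup>2 / 2)"
    using p by (intro integrableI_nonneg) (auto simp: top.not_eq_extremum order_le_less_trans)
  show sq: "integrable M (\<lambda>p. (Y p)\<^sup>2)"
  proof (rule Bochner_Integration.integrable_bound)
    show "integrable M (\<lambda>q. 4 * ((Y p - Y q)\<^sup>2 / 2) + 2 * (Y p)\<^sup>2)"
      by (intro Bochner_Integration.integrable_add integrable_mult_right int) auto
    have "(Y q)\<^sup>2 \<le> 4 * ((Y p - Y q)\<^sup>2 / 2) + 2 * (Y p)\<^sup>2" for q
      using zero_le_power2[of "Y q - 2 * Y p"]
      by (simp add: power2_eq_square algebra_simps diff_divide_distrib add_divide_distrib)
    then show "AE q in M. norm ((Y q)\<^sup>2) \<le> norm (4 * ((Y p - Y q)\<^sup>2 / 2) + 2 * (Y p)\<^sup>2)"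
      by (auto intro: order_trans)
  qed simp
  show "integrable M Y"
  proof (rule Bochner_Integration.integrable_bound)
    show "integrable M (\<lambda>q. (Y q)\<^sup>2 + 1)"
      using sq by simp
    have "\<bar>y\<bar> \<le> y\<^sup>2 + 1" for y :: real
      using zero_le_power2[of "\<bar>y\<bar> - 1"] by (simp add: power2_diff)
    then show "AE q in M. norm (Y q) \<le> norm ((Y q)\<^sup>2 + 1)"
      by (auto intro: order_trans)
  qed simp
qed

lemma AE_semicircle_bounded: "AE x in semicircle. \<bar>x\<bar> < 1"
proof -
  have "\<not> 0 < ennreal (rho_1 x) \<or> \<bar>x\<bar> < 1" for x
    using rho_1_eq_0[of x] by fastforce
  then show ?thesis
    unfolding semicircle_def by (subst AE_density) auto
qed

lemma AE_semicircle_neq: "AE x in semicircle. x \<noteq> c"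
  unfolding semicircle_def using AE_lborel_singleton[of c]
  by (subst AE_density) auto

lemma (in prob_space)
  fixes f :: "'a \<Rightarrow> real"
  assumes f: "integrable M f"
  shows integrable_pair_fst: "integrable (M \<Otimes>\<^sub>M M) (\<lambda>z. f (fst z))"
    and integral_pair_fst: "(\<integral>z. f (fst z) \<partial>(M \<Otimes>\<^sub>M M)) = (\<integral>p. f p \<partial>M)"
    and integrable_pair_snd: "integrable (M \<Otimes>\<^sub>M M) (\<lambda>z. f (snd z))"
    and integral_pair_snd: "(\<integral>z. f (snd z) \<partial>(M \<Otimes>\<^sub>M M)) = (\<integral>p. f p \<partial>M)"
proof -
  interpret pair: pair_prob_space M M ..
  have f': "integrable (distr (M \<Otimes>\<^sub>M M) M fst) f"
    using f by (simp add: distr_pair_fst)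
  then show 1: "integrable (M \<Otimes>\<^sub>M M) (\<lambda>z. f (fst z))"
    by (rule integrable_distr[rotated]) simp
  then show "integrable (M \<Otimes>\<^sub>M M) (\<lambda>z. f (snd z))"
    using pair.integrable_product_swap[OF 1] by (simp add: case_prod_beta')
  show 2: "(\<integral>z. f (fst z) \<partial>(M \<Otimes>\<^sub>M M)) = (\<integral>p. f p \<partial>M)"
    using integral_distr[of fst "M \<Otimes>\<^sub>M M" M f] f by (simp add: distr_pair_fst)
  show "(\<integral>z. f (snd z) \<partial>(M \<Otimes>\<^sub>M M)) = (\<integral>p. f p \<partial>M)"
    using pair.integral_product_swap[of "\<lambda>z. f (fst z)"] 1 2 by (simp add: case_prod_beta')
qed

lemma (in prob_space)
  fixes f g :: "'a \<Rightarrow> real"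
  assumes f: "integrable M f" and g: "integrable M g"
  shows integrable_pair_prod: "integrable (M \<Otimes>\<^sub>M M) (\<lambda>z. f (fst z) * g (snd z))"
    and integral_pair_prod:
      "(\<integral>z. f (fst z) * g (snd z) \<partial>(M \<Otimes>\<^sub>M M)) = (\<integral>p. f p \<partial>M) * (\<integral>p. g p \<partial>M)"
proof -
  interpret pair: pair_prob_space M M ..
  have [measurable]: "f \<in> borel_measurable M" "g \<in> borel_measurable M"
    using f g by simp_all
  have "integrable (M \<Otimes>\<^sub>M M) (\<lambda>z. f (fst z) *\<^sub>R g (snd z))"
    by (rule pair.Fubini_integrable) (use f g in \<open>simp_all add: abs_mult\<close>)
  then show "integrable (M \<Otimes>\<^sub>M M) (\<lambda>z. f (fst z) * g (snd z))"
    by simp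
  from pair.integral_fst'[OF this]
  show "(\<integral>z. f (fst z) * g (snd z) \<partial>(M \<Otimes>\<^sub>M M)) = (\<integral>p. f p \<partial>M) * (\<integral>p. g p \<partial>M)"
    by simp
qed

lemma (in prob_space) integral_pair_diff_mult:
  fixes f g :: "'a \<Rightarrow> real"
  assumes int: "integrable M f" "integrable M g" "integrable M (\<lambda>p. f p * g p)"
  shows "integrable (M \<Otimes>\<^sub>M M) (\<lambda>z. (f (fst z) - f (snd z)) * (g (fst z) - g (snd z)))"
    and "(\<integral>z. (f (fst z) - f (snd z)) * (g (fst z) - g (snd z)) \<partial>(M \<Otimes>\<^sub>M M)) =
      2 * (\<integral>p. f p * g p \<partial>M) - 2 * (\<integral>p. f p \<partial>M) * (\<integral>p. g p \<partial>M)"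
proof -
  have eq: "(f (fst z) - f (snd z)) * (g (fst z) - g (snd z)) =
      f (fst z) * g (fst z) + f (snd z) * g (snd z) - f (fst z) * g (snd z) - g (fst z) * f (snd z)" for z
    by (simp add: algebra_simps)
  note ints = integrable_pair_fst[OF int(3)] integrable_pair_snd[OF int(3)]
    integrable_pair_prod[OF int(1,2)] integrable_pair_prod[OF int(2,1)]
  show "integrable (M \<Otimes>\<^sub>M M) (\<lambda>z. (f (fst z) - f (snd z)) * (g (fst z) - g (snd z)))"
    unfolding eq using ints by simp
  show "(\<integral>z. (f (fst z) - f (snd z)) * (g (fst z) - g (snd z)) \<partial>(M \<Otimes>\<^sub>M M)) =
      2 * (\<integral>p. f p * g p \<partial>M) - 2 * (\<integral>p. f p \<partial>M) * (\<integral>p. g p \<partial>M)"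
    unfolding eq using ints integral_pair_fst[OF int(3)] integral_pair_snd[OF int(3)]
      integral_pair_prod[OF int(1,2)] integral_pair_prod[OF int(2,1)]
    by simp
qed

section \<open>Displacement convexity at the semicircle law\<close>

text \<open>A fixed random variable \<open>X\<close> with semicircle law. Energies of the laws of random variables on the
  same space are expectations over two independent points of it, that is, integrals over the
  square of the space.\<close>

locale semicircle_variable = prob_space M for M :: "'a measure" +
  fixes X :: "'a \<Rightarrow> real"
  assumes X_measurable [measurable]: "X \<in> borel_measurable M"
    and distr_X: "distr M borel X = semicircle"
begin

sublocale pair: pair_prob_space M M ..

lemma integral_X:
  "f \<in> borel_measurable borel \<Longrightarrow> (\<integral>p. f (X p) \<partial>M) = (\<integral>x. f x \<partial>semicircle)" for f :: "real \<Rightarrow> real"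
  by (simp add: distr_X[symmetric] integral_distr)

lemma integrable_X:
  "f \<in> borel_measurable borel \<Longrightarrow> integrable M (\<lambda>p. f (X p)) \<longleftrightarrow> integrable semicircle f"
  for f :: "real \<Rightarrow> real"
  by (simp add: distr_X[symmetric] integrable_distr_eq)

lemma AE_X: "Measurable.pred borel P \<Longrightarrow> (AE p in M. P (X p)) \<longleftrightarrow> (AE x in semicircle. P x)"
  unfolding distr_X[symmetric] by (subst AE_distr_iff) (auto simp: pred_def)

lemma AE_X_bounded: "AE p in M. \<bar>X p\<bar> < 1"
  using AE_semicircle_bounded by (subst AE_X) auto

lemma AE_pair_X_bounded:
  "AE z in M \<Otimes>\<^sub>M M. \<bar>X (fst z)\<bar> < 1 \<and> \<bar>X (snd z)\<bar> < 1"
proof (rule pair.AE_pair_measure)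
  show "AE p in M. AE q in M. \<bar>X (fst (p, q))\<bar> < 1 \<and> \<bar>X (snd (p, q))\<bar> < 1"
    using AE_X_bounded by (auto intro!: AE_I2 elim!: eventually_mono)
qed measurable

lemma AE_pair_X_neq: "AE z in M \<Otimes>\<^sub>M M. X (fst z) \<noteq> X (snd z)"
proof (rule pair.AE_pair_measure)
  have "AE q in M. X q \<noteq> c" for c
    using AE_semicircle_neq[of c] by (subst AE_X) auto
  then show "AE p in M. AE q in M. X (fst (p, q)) \<noteq> X (snd (p, q))"
    by (simp add: eq_commute)
qed measurable

text \<open>The smoothed kernel is bounded and antisymmetric, so Fubini's theorem reduces the double integral
  to the smoothed Hilbert transform of the semicircle law.\<close>
lemma
  assumes r: "0 < r" "r < 1"
    and Y [measurable]: "integrable M Y"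
  shows integrable_smoothed_hilbert:
      "integrable (M \<Otimes>\<^sub>M M) (\<lambda>z. (Y (fst z) - Y (snd z)) * smoothed_hilbert r (X (fst z)) (X (snd z)))"
    and integral_smoothed_hilbert:
      "(\<integral>z. (Y (fst z) - Y (snd z)) * smoothed_hilbert r (X (fst z)) (X (snd z)) \<partial>(M \<Otimes>\<^sub>M M)) =
        2 * r * (1 + r) * (\<integral>p. X p * Y p \<partial>M)"
proof -
  define H where "H z = Y (fst z) * smoothed_hilbert r (X (fst z)) (X (snd z))" for z
  have [measurable]: "Y \<in> borel_measurable M"
    using Y by simp
  have [measurable]: "H \<in> borel_measurable (M \<Otimes>\<^sub>M M)"
    unfolding H_def by measurable
  have int_H: "integrable (M \<Otimes>\<^sub>M M) H"
  proof (rule Bochner_Integration.integrable_bound)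
    show "integrable (M \<Otimes>\<^sub>M M) (\<lambda>z. 8 / (1 - r) ^ 4 * Y (fst z))"
      by (intro integrable_mult_right integrable_pair_fst Y)
    show "AE z in M \<Otimes>\<^sub>M M. norm (H z) \<le> norm (8 / (1 - r) ^ 4 * Y (fst z))"
      using AE_pair_X_bounded
    proof eventually_elim
      case (elim z)
      then have "\<bar>smoothed_hilbert r (X (fst z)) (X (snd z))\<bar> \<le> 8 / (1 - r) ^ 4"
        using smoothed_hilbert_bound r by auto
      from mult_left_mono[OF this, of "\<bar>Y (fst z)\<bar>"] show ?case
        by (simp add: H_def abs_mult mult.commute)
    qed
  qed measurable
  have "(\<integral>z. H z \<partial>(M \<Otimes>\<^sub>M M)) = (\<integral>p. (\<integral>q. H (p, q) \<partial>M) \<partial>M)"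
    by (rule pair.integral_fst'[OF int_H, symmetric])
  also have "\<dots> = (\<integral>p. r * (1 + r) * (X p * Y p) \<partial>M)"
  proof (rule integral_cong_AE)
    show "AE p in M. (\<integral>q. H (p, q) \<partial>M) = r * (1 + r) * (X p * Y p)"
      using AE_X_bounded
    proof eventually_elim
      case (elim p)
      then show ?case
        using r by (simp add: H_def integral_X[of "smoothed_hilbert r (X p)"] smoothed_hilbert_integral)
    qed
  qed measurable
  finally have H: "(\<integral>z. H z \<partial>(M \<Otimes>\<^sub>M M)) = r * (1 + r) * (\<integral>p. X p * Y p \<partial>M)"
    by simp
  have swap: "(Y (fst z) - Y (snd z)) * smoothed_hilbert r (X (fst z)) (X (snd z)) =
      H z + H (snd z, fst z)" for z
    using smoothed_hilbert_swap[of r "X (snd z)"] by (simp add: H_def left_diff_distrib)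
  have int_swap: "integrable (M \<Otimes>\<^sub>M M) (\<lambda>z. H (snd z, fst z))"
    using pair.integrable_product_swap[OF int_H] by (simp add: case_prod_beta')
  show "integrable (M \<Otimes>\<^sub>M M)
      (\<lambda>z. (Y (fst z) - Y (snd z)) * smoothed_hilbert r (X (fst z)) (X (snd z)))"
    unfolding swap using int_H int_swap by simp
  have "(\<integral>z. H (snd z, fst z) \<partial>(M \<Otimes>\<^sub>M M)) = (\<integral>z. H z \<partial>(M \<Otimes>\<^sub>M M))"
    using pair.integral_product_swap[of H] by (simp add: case_prod_beta')
  then show "(\<integral>z. (Y (fst z) - Y (snd z)) * smoothed_hilbert r (X (fst z)) (X (snd z)) \<partial>(M \<Otimes>\<^sub>M M)) =
        2 * r * (1 + r) * (\<integral>p. X p * Y p \<partial>M)"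
    unfolding swap using int_H int_swap H by simp
qed

text \<open>If \<open>Y\<close> increases with \<open>X\<close>, the difference quotients are nonnegative, and so are their
  smoothed versions. Fatou's lemma therefore passes to the singular kernel without any estimate of
  a principal value. It yields an inequality only, in the direction that the convexity argument
  requires.\<close>
lemma
  assumes Y [measurable]: "integrable M Y"
    and comonotone: "\<And>p q. p \<in> space M \<Longrightarrow> q \<in> space M \<Longrightarrow> 0 \<le> (X p - X q) * (Y p - Y q)"
  shows comonotone_quotient_integrable:
      "integrable (M \<Otimes>\<^sub>M M) (\<lambda>z. (Y (fst z) - Y (snd z)) / (X (fst z) - X (snd z)))"
    and comonotone_quotient_le:
      "(\<integral>z. (Y (fst z) - Y (snd z)) / (X (fst z) - X (snd z)) \<partial>(M \<Otimes>\<^sub>M M)) \<le> 4 * (\<integral>p. X p * Y p \<partial>M)"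
proof -
  have [measurable]: "Y \<in> borel_measurable M"
    using Y by simp
  define r where "r n = 1 - 1 / (real n + 2)" for n
  have r: "0 < r n" "r n < 1" for n
    by (simp_all add: r_def field_simps)
  have r_lim: "r \<longlonglongrightarrow> 1"
    unfolding r_def by real_asymp
  define q where "q z = (Y (fst z) - Y (snd z)) / (X (fst z) - X (snd z))" for z
  define h where "h n z = (Y (fst z) - Y (snd z)) * smoothed_hilbert (r n) (X (fst z)) (X (snd z))" for n z
  have [measurable]: "q \<in> borel_measurable (M \<Otimes>\<^sub>M M)" "h n \<in> borel_measurable (M \<Otimes>\<^sub>M M)" for n
    unfolding q_def h_def by measurable
  have h_nonneg: "AE z in M \<Otimes>\<^sub>M M. 0 \<le> h n z" for n
    using AE_pair_X_bounded AE_space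
  proof eventually_elim
    case (elim z)
    then show ?case
      unfolding h_def using r comonotone
      by (intro smoothed_hilbert_sign) (auto simp: space_pair_measure)
  qed
  have h_integral: "(\<integral>\<^sup>+z. ennreal (h n z) \<partial>(M \<Otimes>\<^sub>M M)) =
      ennreal (2 * r n * (1 + r n) * (\<integral>p. X p * Y p \<partial>M))" for n
    using nn_integral_eq_integral[OF _ h_nonneg[of n]] integrable_smoothed_hilbert[OF r Y, of n]
      integral_smoothed_hilbert[OF r Y, of n]
    by (simp add: h_def)
  have lim: "AE z in M \<Otimes>\<^sub>M M. ennreal (q z) = liminf (\<lambda>n. ennreal (h n z))"
    using AE_pair_X_neq
  proof eventually_elim
    case (elim z)
    have "filterlim r (at 1) sequentially"
      using r_lim r by (auto simp: filterlim_at less_imp_neq intro!: always_eventually)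
    from filterlim_compose[OF smoothed_hilbert_tendsto[OF elim] this]
    have "(\<lambda>n. h n z) \<longlonglongrightarrow> (Y (fst z) - Y (snd z)) * (1 / (X (fst z) - X (snd z)))"
      unfolding h_def by (intro tendsto_mult tendsto_const)
    then have "(\<lambda>n. ennreal (h n z)) \<longlonglongrightarrow> ennreal (q z)"
      by (intro tendsto_ennrealI) (simp add: q_def)
    then show ?case
      by (intro lim_imp_Liminf[symmetric]) auto
  qed
  have "(\<integral>\<^sup>+z. ennreal (q z) \<partial>(M \<Otimes>\<^sub>M M)) = (\<integral>\<^sup>+z. liminf (\<lambda>n. ennreal (h n z)) \<partial>(M \<Otimes>\<^sub>M M))"
    by (rule nn_integral_cong_AE[OF lim])
  also have "\<dots> \<le> liminf (\<lambda>n. \<integral>\<^sup>+z. ennreal (h n z) \<partial>(M \<Otimes>\<^sub>M M))"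
    by (rule nn_integral_liminf) measurable
  also have "\<dots> = ennreal (2 * 1 * (1 + 1) * (\<integral>p. X p * Y p \<partial>M))"
    unfolding h_integral
    by (intro lim_imp_Liminf tendsto_ennrealI tendsto_intros r_lim) auto
  finally have le: "(\<integral>\<^sup>+z. ennreal (q z) \<partial>(M \<Otimes>\<^sub>M M)) \<le> ennreal (4 * (\<integral>p. X p * Y p \<partial>M))"
    by simp
  have q_nonneg: "AE z in M \<Otimes>\<^sub>M M. 0 \<le> q z"
    using AE_space
  proof eventually_elim
    case (elim z)
    then have "0 \<le> (X (fst z) - X (snd z)) * (Y (fst z) - Y (snd z))"
      by (intro comonotone) (auto simp: space_pair_measure)
    then show ?case
      by (auto simp: q_def zero_le_divide_iff zero_le_mult_iff)
  qed
  show int: "integrable (M \<Otimes>\<^sub>M M) (\<lambda>z. (Y (fst z) - Y (snd z)) / (X (fst z) - X (snd z)))"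
    unfolding q_def[symmetric] using q_nonneg le
    by (intro integrableI_nonneg) (auto simp: order_le_less_trans)
  have "0 \<le> (\<integral>z. h 0 z \<partial>(M \<Otimes>\<^sub>M M))"
    using h_nonneg by (rule integral_nonneg_AE)
  then have "0 \<le> 2 * r 0 * (1 + r 0) * (\<integral>p. X p * Y p \<partial>M)"
    using integral_smoothed_hilbert[OF r Y, of 0] by (simp only: h_def)
  moreover have "0 < 2 * r 0 * (1 + r 0)"
    using r[of 0] by simp
  ultimately have "0 \<le> (\<integral>p. X p * Y p \<partial>M)"
    using mult_pos_neg by (metis not_le)
  then show "(\<integral>z. (Y (fst z) - Y (snd z)) / (X (fst z) - X (snd z)) \<partial>(M \<Otimes>\<^sub>M M)) \<le> 4 * (\<integral>p. X p * Y p \<partial>M)"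
    using le nn_integral_eq_integral[OF int[folded q_def] q_nonneg]
    by (simp add: q_def[symmetric])
qed

text \<open>Displacement convexity with an explicit remainder. For \<open>a = X p - X q\<close> and \<open>b = Y p - Y q\<close> the
  tangent inequality bounds the energy of \<open>Y\<close> from below by that of \<open>X\<close>, plus the integral of
  \<open>(b - a)\<^sup>2\<close>, plus the integral of the first-order term
  \<open>1 - b / a + 2 * a * b - 2 * a\<^sup>2\<close>. The last is at least
  \<open>1 - 4 * m + 4 * m - 2 / 2 = 0\<close>, where \<open>m\<close> is the expectation of \<open>X * Y\<close>; the second moment
  \<open>1 / 4\<close> of the semicircle law enters through the integral \<open>1 / 2\<close> of \<open>a\<^sup>2\<close>.\<close>

theorem comonotone_log_energy_gap:
  assumes Y [measurable]: "Y \<in> borel_measurable M"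
    and comonotone: "\<And>p q. p \<in> space M \<Longrightarrow> q \<in> space M \<Longrightarrow> 0 \<le> (X p - X q) * (Y p - Y q)"
  shows "(\<integral>\<^sup>+z. log_quad (X (fst z) - X (snd z)) \<partial>(M \<Otimes>\<^sub>M M))
      + (\<integral>\<^sup>+z. ennreal (((Y (fst z) - Y (snd z)) - (X (fst z) - X (snd z)))\<^sup>2) \<partial>(M \<Otimes>\<^sub>M M))
    \<le> (\<integral>\<^sup>+z. log_quad (Y (fst z) - Y (snd z)) \<partial>(M \<Otimes>\<^sub>M M))"
proof (cases "(\<integral>\<^sup>+z. log_quad (Y (fst z) - Y (snd z)) \<partial>(M \<Otimes>\<^sub>M M)) = \<infinity>")
  case False
  define a where "a z = X (fst z) - X (snd z)" for z
  define b where "b z = Y (fst z) - Y (snd z)" for z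
  define k where "k t = t\<^sup>2 - ln \<bar>t\<bar>" for t :: real
  have [measurable]: "a \<in> borel_measurable (M \<Otimes>\<^sub>M M)" "b \<in> borel_measurable (M \<Otimes>\<^sub>M M)"
      "k \<in> borel_measurable borel"
    unfolding a_def b_def k_def by measurable
  have log_quad_k: "t \<noteq> 0 \<Longrightarrow> log_quad t = ennreal (k t)" for t
    by (simp add: log_quad_def k_def)
  have fin: "(\<integral>\<^sup>+z. log_quad (b z) \<partial>(M \<Otimes>\<^sub>M M)) \<noteq> \<infinity>"
    using False by (simp add: b_def)
  have a_neq: "AE z in M \<Otimes>\<^sub>M M. a z \<noteq> 0"
    using AE_pair_X_neq by (simp add: a_def)
  have b_neq: "AE z in M \<Otimes>\<^sub>M M. b z \<noteq> 0"
    using nn_integral_PInf_AE[OF _ fin] by (auto simp: log_quad_def)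
  have int_Y: "integrable M Y" "integrable M (\<lambda>p. Y p * Y p)"
    using square_integrable_of_finite_log_energy[OF Y] fin by (auto simp: b_def power2_eq_square)
  have X_moments: "integrable M X" "(\<integral>p. X p \<partial>M) = 0"
    using iffD2[OF integrable_X[of "\<lambda>x. x"] semicircle_mean(1)]
      trans[OF integral_X[of "\<lambda>x. x"] semicircle_mean(2)] by simp_all
  have X_second_moment: "integrable M (\<lambda>p. X p * X p)" "(\<integral>p. X p * X p \<partial>M) = 1 / 4"
    using iffD2[OF integrable_X[of "\<lambda>x. x\<^sup>2"] semicircle_second_moment(1)]
      trans[OF integral_X[of "\<lambda>x. x\<^sup>2"] semicircle_second_moment(2)]
    unfolding power2_eq_square by measurable
  have int_XY: "integrable M (\<lambda>p. X p * Y p)"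
  proof (rule Bochner_Integration.integrable_bound[OF int_Y(1)])
    show "AE p in M. norm (X p * Y p) \<le> norm (Y p)"
      using AE_X_bounded
    proof eventually_elim
      case (elim p)
      then show ?case
        using mult_right_mono[of "\<bar>X p\<bar>" 1 "\<bar>Y p\<bar>"] by (simp add: abs_mult)
    qed
  qed measurable
  define m where "m = (\<integral>p. X p * Y p \<partial>M)"
  have kb: "integrable (M \<Otimes>\<^sub>M M) (\<lambda>z. k (b z))"
    and kb_eq: "(\<integral>\<^sup>+z. log_quad (b z) \<partial>(M \<Otimes>\<^sub>M M)) = ennreal (\<integral>z. k (b z) \<partial>(M \<Otimes>\<^sub>M M))"
  proof -
    have eq: "(\<integral>\<^sup>+z. log_quad (b z) \<partial>(M \<Otimes>\<^sub>M M)) = (\<integral>\<^sup>+z. ennreal (k (b z)) \<partial>(M \<Otimes>\<^sub>M M))"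
      using b_neq by (intro nn_integral_cong_AE) (auto simp: log_quad_k)
    have nonneg: "AE z in M \<Otimes>\<^sub>M M. 0 \<le> k (b z)"
      using b_neq unfolding k_def by eventually_elim (rule log_quad_nonneg)
    show "integrable (M \<Otimes>\<^sub>M M) (\<lambda>z. k (b z))"
      using fin nonneg unfolding eq by (intro integrableI_nonneg) (auto simp: top.not_eq_extremum)
    from nn_integral_eq_integral[OF this nonneg]
    show "(\<integral>\<^sup>+z. log_quad (b z) \<partial>(M \<Otimes>\<^sub>M M)) = ennreal (\<integral>z. k (b z) \<partial>(M \<Otimes>\<^sub>M M))"
      unfolding eq .
  qed
  have ab: "integrable (M \<Otimes>\<^sub>M M) (\<lambda>z. a z * b z)" "(\<integral>z. a z * b z \<partial>(M \<Otimes>\<^sub>M M)) = 2 * m"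
    using integral_pair_diff_mult[OF X_moments(1) int_Y(1) int_XY] X_moments
    by (simp_all add: a_def b_def m_def)
  have aa: "integrable (M \<Otimes>\<^sub>M M) (\<lambda>z. a z * a z)" "(\<integral>z. a z * a z \<partial>(M \<Otimes>\<^sub>M M)) = 1 / 2"
    using integral_pair_diff_mult[OF X_moments(1) X_moments(1) X_second_moment(1)] X_moments X_second_moment
    by (simp_all add: a_def)
  have quot: "integrable (M \<Otimes>\<^sub>M M) (\<lambda>z. b z / a z)" "(\<integral>z. b z / a z \<partial>(M \<Otimes>\<^sub>M M)) \<le> 4 * m"
    using comonotone_quotient_integrable[OF int_Y(1) comonotone]
      comonotone_quotient_le[OF int_Y(1) comonotone]
    by (simp_all add: a_def b_def m_def)
  define u where "u z = k (b z) - 1 + b z / a z - 2 * (a z * b z) + 2 * (a z * a z)" for z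
  have int_u: "integrable (M \<Otimes>\<^sub>M M) u"
    unfolding u_def using kb ab aa quot by simp
  have pointwise: "AE z in M \<Otimes>\<^sub>M M. 0 \<le> k (a z) \<and> k (a z) + (b z - a z)\<^sup>2 \<le> u z"
    using a_neq b_neq AE_space
  proof eventually_elim
    case (elim z)
    then have "0 \<le> a z * b z"
      unfolding a_def b_def by (intro comonotone) (auto simp: space_pair_measure)
    with elim show ?case
      using log_quad_convex[of "a z" "b z"] log_quad_nonneg[of "a z"]
      by (simp add: k_def u_def power2_eq_square)
  qed
  have "(\<integral>\<^sup>+z. log_quad (a z) \<partial>(M \<Otimes>\<^sub>M M)) + (\<integral>\<^sup>+z. ennreal ((b z - a z)\<^sup>2) \<partial>(M \<Otimes>\<^sub>M M)) =
      (\<integral>\<^sup>+z. log_quad (a z) + ennreal ((b z - a z)\<^sup>2) \<partial>(M \<Otimes>\<^sub>M M))"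
    by (intro nn_integral_add[symmetric]) measurable
  also have "\<dots> \<le> (\<integral>\<^sup>+z. ennreal (u z) \<partial>(M \<Otimes>\<^sub>M M))"
  proof (rule nn_integral_mono_AE)
    show "AE z in M \<Otimes>\<^sub>M M. log_quad (a z) + ennreal ((b z - a z)\<^sup>2) \<le> ennreal (u z)"
      using pointwise a_neq
      by eventually_elim (auto simp: log_quad_k ennreal_plus[symmetric] simp del: ennreal_plus intro!: ennreal_leI)
  qed
  also have "\<dots> = ennreal (\<integral>z. u z \<partial>(M \<Otimes>\<^sub>M M))"
  proof (rule nn_integral_eq_integral[OF int_u])
    show "AE z in M \<Otimes>\<^sub>M M. 0 \<le> u z"
      using pointwise
    proof eventually_elim
      case (elim z)
      then show ?case
        using zero_le_power2[of "b z - a z"] by linarith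
    qed
  qed
  also have "\<dots> \<le> ennreal (\<integral>z. k (b z) \<partial>(M \<Otimes>\<^sub>M M))"
  proof (rule ennreal_leI)
    have "(\<integral>z. u z \<partial>(M \<Otimes>\<^sub>M M)) = (\<integral>z. k (b z) \<partial>(M \<Otimes>\<^sub>M M)) - 1
        + (\<integral>z. b z / a z \<partial>(M \<Otimes>\<^sub>M M)) - 2 * (2 * m) + 2 * (1 / 2)"
      unfolding u_def using kb ab aa quot by (simp add: pair.prob_space)
    with quot(2) show "(\<integral>z. u z \<partial>(M \<Otimes>\<^sub>M M)) \<le> (\<integral>z. k (b z) \<partial>(M \<Otimes>\<^sub>M M))"
      by simp
  qed
  also have "\<dots> = (\<integral>\<^sup>+z. log_quad (b z) \<partial>(M \<Otimes>\<^sub>M M))"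
    by (rule kb_eq[symmetric])
  finally show ?thesis
    by (simp add: a_def b_def)
qed simp

end

section \<open>Uniqueness of the minimizer on the line\<close>

definition log_energy :: "real measure \<Rightarrow> ennreal" where
  "log_energy \<nu> = (\<integral>\<^sup>+s. (\<integral>\<^sup>+t. log_quad (s - t) \<partial>\<nu>) \<partial>\<nu>)"

lemma real_distribution_semicircle: "real_distribution semicircle"
  using prob_space_semicircle
  by (simp add: real_distribution_def real_distribution_axioms_def)

lemma (in prob_space) log_energy_distr:
  assumes [measurable]: "Y \<in> borel_measurable M"
  shows "log_energy (distr M borel Y) = (\<integral>\<^sup>+z. log_quad (Y (fst z) - Y (snd z)) \<partial>(M \<Otimes>\<^sub>M M))"
proof -
  have "log_energy (distr M borel Y) = (\<integral>\<^sup>+p. (\<integral>\<^sup>+t. log_quad (Y p - t) \<partial>distr M borel Y) \<partial>M)"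
  proof -
    interpret Y: prob_space "distr M borel Y"
      by (rule prob_space_distr) simp
    show ?thesis
      unfolding log_energy_def by (rule nn_integral_distr) measurable
  qed
  also have "\<dots> = (\<integral>\<^sup>+p. (\<integral>\<^sup>+q. log_quad (Y p - Y q) \<partial>M) \<partial>M)"
    by (intro nn_integral_cong nn_integral_distr) measurable
  also have "\<dots> = (\<integral>\<^sup>+z. log_quad (Y (fst z) - Y (snd z)) \<partial>(M \<Otimes>\<^sub>M M))"
    using nn_integral_fst[of "\<lambda>z. log_quad (Y (fst z) - Y (snd z))" M] by simp
  finally show ?thesis .
qed

text \<open>The quantile functions of two laws are increasing functions on the same interval \<open>(0, 1)\<close>.\<close>

lemma quantile_coupling:
  assumes "real_distribution \<mu>" "real_distribution \<nu>"
  obtains M :: "real measure" and X Y :: "real \<Rightarrow> real"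
  where "prob_space M" "X \<in> borel_measurable M" "Y \<in> borel_measurable M"
    "distr M borel X = \<mu>" "distr M borel Y = \<nu>"
    "\<And>p q. p \<in> space M \<Longrightarrow> q \<in> space M \<Longrightarrow> 0 \<le> (X p - X q) * (Y p - Y q)"
proof -
  interpret mu: cdf_distribution \<mu>
    using assms by (simp add: cdf_distribution_def)
  interpret nu: cdf_distribution \<nu>
    using assms by (simp add: cdf_distribution_def)
  let ?M = "restrict_space lborel {0<..<1::real}"
  show thesis
  proof (rule that)
    show "prob_space ?M"
      by (auto simp add: emeasure_restrict_space space_restrict_space intro!: prob_spaceI)
    have M: "borel_measurable ?M = borel_measurable (restrict_space borel {0<..<1::real})"
      by (intro measurable_cong_sets sets_restrict_space_cong) auto
    show "mu.I \<in> borel_measurable ?M" "nu.I \<in> borel_measurable ?M"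
      unfolding M by (rule mu.measurable_CI nu.measurable_CI)+
    show "distr ?M borel mu.I = \<mu>" "distr ?M borel nu.I = \<nu>"
      by (rule mu.distr_I_eq_M nu.distr_I_eq_M)+
    have "0 \<le> (mu.I p - mu.I q) * (nu.I p - nu.I q)" if "p \<in> {0<..<1}" "q \<in> {0<..<1}" for p q
      using mono_onD[OF mu.mono_I, of p q] mono_onD[OF mu.mono_I, of q p]
        mono_onD[OF nu.mono_I, of p q] mono_onD[OF nu.mono_I, of q p] that
      by (cases "p \<le> q") (auto intro: mult_nonneg_nonneg mult_nonpos_nonpos)
    then show "\<And>p q. p \<in> space ?M \<Longrightarrow> q \<in> space ?M \<Longrightarrow> 0 \<le> (mu.I p - mu.I q) * (nu.I p - nu.I q)"
      by (simp add: space_restrict_space)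
  qed
qed

text \<open>A minimizer makes the quadratic remainder of the energy gap vanish. Then \<open>Y - X\<close> takes the same
  value at almost all pairs of points, which says that \<open>\<nu>\<close> is a translate.\<close>
theorem
  assumes \<nu>: "real_distribution \<nu>"
  shows semicircle_minimizes_log_energy: "log_energy semicircle \<le> log_energy \<nu>"
    and semicircle_unique_log_energy_minimizer:
      "log_energy semicircle \<noteq> \<infinity> \<Longrightarrow> log_energy \<nu> \<le> log_energy semicircle \<Longrightarrow>
        \<exists>c. \<nu> = distr semicircle borel (\<lambda>x. x + c)"
proof -
  from real_distribution_semicircle \<nu>
  obtain M :: "real measure" and X Y :: "real \<Rightarrow> real"
    where M: "prob_space M" and [measurable]: "X \<in> borel_measurable M" "Y \<in> borel_measurable M"
      and distr: "distr M borel X = semicircle" "distr M borel Y = \<nu>"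
      and comonotone: "\<And>p q. p \<in> space M \<Longrightarrow> q \<in> space M \<Longrightarrow> 0 \<le> (X p - X q) * (Y p - Y q)"
    by (rule quantile_coupling) blast
  interpret semicircle_variable M X
    using M distr by (simp add: semicircle_variable_def semicircle_variable_axioms_def)
  define defect where
    "defect = (\<integral>\<^sup>+z. ennreal (((Y (fst z) - Y (snd z)) - (X (fst z) - X (snd z)))\<^sup>2) \<partial>(M \<Otimes>\<^sub>M M))"
  have gap: "log_energy semicircle + defect \<le> log_energy \<nu>"
    using comonotone_log_energy_gap[OF _ comonotone]
    by (simp add: distr[symmetric] log_energy_distr defect_def)
  then show "log_energy semicircle \<le> log_energy \<nu>"
    by (rule order_trans[rotated]) simp
  assume fin: "log_energy semicircle \<noteq> \<infinity>" and le: "log_energy \<nu> \<le> log_energy semicircle"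
  have "log_energy semicircle + defect \<le> log_energy semicircle + 0"
    using order_trans[OF gap le] by (simp only: add_0_right)
  then have "defect = 0"
    using fin by (simp add: ennreal_add_left_cancel_le)
  then have "AE z in M \<Otimes>\<^sub>M M. (Y (fst z) - Y (snd z)) - (X (fst z) - X (snd z)) = 0"
    unfolding defect_def by (subst (asm) nn_integral_0_iff_AE) auto
  then have "AE p in M. AE q in M. Y q = X q + (Y p - X p)"
    using pair.AE_pair[of "\<lambda>z. (Y (fst z) - Y (snd z)) - (X (fst z) - X (snd z)) = 0"]
    by (auto elim!: eventually_mono)
  then obtain p where "AE q in M. Y q = X q + (Y p - X p)"
    using AE_contr by blast
  then have "distr M borel Y = distr M borel (\<lambda>q. X q + (Y p - X p))"
    by (intro distr_cong_AE) auto
  also have "\<dots> = distr semicircle borel (\<lambda>x. x + (Y p - X p))"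
    unfolding distr(1)[symmetric] by (subst distr_distr) (auto simp: comp_def)
  finally show "\<exists>c. \<nu> = distr semicircle borel (\<lambda>x. x + c)"
    unfolding distr(2) by blast
qed

section \<open>Averages of the interaction over projections\<close>

lemma nn_integral_neg_log_finite:
  "(\<integral>\<^sup>+s. ennreal (max 0 (- ln \<bar>s\<bar>)) \<partial>lborel) < \<infinity>"
proof -
  define f :: "real \<Rightarrow> ennreal" where "f s = ennreal (2 * s powr (- 1 / 2)) * indicator {0..1} s" for s
  have [measurable]: "f \<in> borel_measurable borel"
    unfolding f_def by measurable
  have "((\<lambda>s. 2 * s powr (- 1 / 2)) has_integral 2 * (1 powr (- 1 / 2 + 1) / (- 1 / 2 + 1))) {0..1::real}"
    by (intro has_integral_mult_right has_integral_powr_from_0) auto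
  from nn_integral_has_integral_lebesgue'[OF _ this]
  have f_fin: "(\<integral>\<^sup>+s. f s \<partial>lborel) = ennreal 4"
    by (simp add: f_def)
  then have f_fin': "(\<integral>\<^sup>+s. f (- s) \<partial>lborel) = ennreal 4"
    using nn_integral_real_affine[of f "- 1" 0] by simp
  have bound: "- ln t \<le> 2 * t powr (- 1 / 2)" if "0 < t" for t :: real
    using ln_le_minus_one[of "t powr (- 1 / 2)"] that by (simp add: ln_powr)
  have "ennreal (max 0 (- ln \<bar>s\<bar>)) \<le> f s + f (- s)" for s
  proof (cases "s = 0 \<or> 1 \<le> \<bar>s\<bar>")
    case False
    then have "ennreal (max 0 (- ln \<bar>s\<bar>)) \<le> ennreal (2 * \<bar>s\<bar> powr (- 1 / 2))"
      using bound[of "\<bar>s\<bar>"] by (intro ennreal_leI) auto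
    also have "\<dots> \<le> f s + f (- s)"
      using False by (cases "0 \<le> s") (auto simp: f_def indicator_def)
    finally show ?thesis .
  qed (auto simp: max_def)
  then have "(\<integral>\<^sup>+s. ennreal (max 0 (- ln \<bar>s\<bar>)) \<partial>lborel) \<le> (\<integral>\<^sup>+s. f s + f (- s) \<partial>lborel)"
    by (rule nn_integral_mono)
  also have "\<dots> = ennreal 4 + ennreal 4"
    using f_fin f_fin' by (subst nn_integral_add) auto
  also have "\<dots> < \<infinity>"
    by simp
  finally show ?thesis .
qed

text \<open>The density of the semicircle law is at most \<open>1\<close>, so its potential is bounded by the integral of
  the logarithmic singularity over the whole line, uniformly in the position \<open>z\<close>.\<close>

lemma semicircle_log_potential_bounded:
  obtains B :: real where "0 \<le> B"
    and "\<And>z. (\<integral>\<^sup>+u. ennreal (max 0 (- ln \<bar>u + z\<bar>)) \<partial>semicircle) \<le> ennreal B"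
proof
  define I where "I = (\<integral>\<^sup>+s. ennreal (max 0 (- ln \<bar>s\<bar>)) \<partial>lborel)"
  show "0 \<le> enn2real I"
    by simp
  fix z :: real
  have "rho_1 u \<le> 1" for u
  proof -
    have "sqrt (max 0 (1 - u\<^sup>2)) \<le> 1"
      by (simp add: max_def)
    then have "2 / pi * sqrt (max 0 (1 - u\<^sup>2)) \<le> 1 * 1"
      using pi_ge_two by (intro mult_mono) auto
    then show ?thesis
      by (simp add: rho_1_def)
  qed
  then have "ennreal (rho_1 u) * c \<le> c" for u and c :: ennreal
    using mult_right_mono[of "ennreal (rho_1 u)" 1 c] by simp
  then have "(\<integral>\<^sup>+u. ennreal (max 0 (- ln \<bar>u + z\<bar>)) \<partial>semicircle) \<le>
      (\<integral>\<^sup>+u. ennreal (max 0 (- ln \<bar>u + z\<bar>)) \<partial>lborel)"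
    unfolding semicircle_def
    by (subst nn_integral_density) (auto intro!: nn_integral_mono)
  also have "\<dots> = I"
    using nn_integral_real_affine[of "\<lambda>s. ennreal (max 0 (- ln \<bar>s\<bar>))" 1 z]
    by (simp add: I_def add.commute)
  also have "\<dots> = ennreal (enn2real I)"
    using nn_integral_neg_log_finite by (simp add: I_def)
  finally show "(\<integral>\<^sup>+u. ennreal (max 0 (- ln \<bar>u + z\<bar>)) \<partial>semicircle) \<le> ennreal (enn2real I)" .
qed

lemma log_energy_semicircle_finite: "log_energy semicircle < \<infinity>"
proof -
  interpret prob_space semicircle
    by (rule prob_space_semicircle)
  obtain B where B: "0 \<le> B"
      "\<And>z. (\<integral>\<^sup>+u. ennreal (max 0 (- ln \<bar>u + z\<bar>)) \<partial>semicircle) \<le> ennreal B"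
    by (rule semicircle_log_potential_bounded) blast
  have inner: "(\<integral>\<^sup>+t. log_quad (s - t) \<partial>semicircle) \<le> ennreal (B + 4)" if s: "\<bar>s\<bar> < 1" for s
  proof -
    have "(\<integral>\<^sup>+t. log_quad (s - t) \<partial>semicircle) \<le>
        (\<integral>\<^sup>+t. ennreal (max 0 (- ln \<bar>t + (- s)\<bar>)) + ennreal 4 \<partial>semicircle)"
    proof (rule nn_integral_mono_AE)
      show "AE t in semicircle. log_quad (s - t) \<le> ennreal (max 0 (- ln \<bar>t + (- s)\<bar>)) + ennreal 4"
        using AE_semicircle_neq[of s] AE_semicircle_bounded
      proof eventually_elim
        case (elim t)
        have "\<bar>s - t\<bar> \<le> 2"
          using s elim by linarith
        then have "(s - t)\<^sup>2 \<le> 2\<^sup>2"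
          by (metis abs_ge_zero power2_abs power_mono)
        moreover have "- ln \<bar>s - t\<bar> \<le> max 0 (- ln \<bar>t + (- s)\<bar>)"
          by (simp add: abs_minus_commute)
        ultimately have "ennreal ((s - t)\<^sup>2 - ln \<bar>s - t\<bar>) \<le> ennreal (max 0 (- ln \<bar>t + (- s)\<bar>) + 4)"
          by (intro ennreal_leI) simp
        then show ?case
          using elim by (simp add: log_quad_def)
      qed
    qed
    also have "\<dots> \<le> ennreal B + ennreal 4"
      using B(2)[of "- s"] emeasure_space_1
      by (subst nn_integral_add) (auto intro: add_mono)
    finally show ?thesis
      using B(1) by simp
  qed
  have "log_energy semicircle \<le> (\<integral>\<^sup>+s. ennreal (B + 4) \<partial>semicircle)"
    unfolding log_energy_def
    using AE_semicircle_bounded inner by (intro nn_integral_mono_AE) (auto elim!: eventually_mono)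
  also have "\<dots> < \<infinity>"
    using emeasure_space_1 by (simp add: ennreal_mult_less_top)
  finally show ?thesis .
qed

lemma nn_integral_log_quad_affine_le:
  assumes w: "(w1, w2) \<noteq> (0, 0::real)" and f: "integrable semicircle f"
    and le: "\<And>u. \<bar>u\<bar> < 1 \<Longrightarrow> w2 + u * w1 \<noteq> 0 \<Longrightarrow> (w2 + u * w1)\<^sup>2 - ln \<bar>w2 + u * w1\<bar> \<le> f u"
  shows "(\<integral>\<^sup>+u. log_quad (w2 + u * w1) \<partial>semicircle) \<le> ennreal (\<integral>u. f u \<partial>semicircle)"
proof -
  have "w2 + u * w1 \<noteq> 0" if "u \<noteq> - w2 / w1" for u
    using w that by (cases "w1 = 0") (auto simp: field_simps)
  then have neq: "AE u in semicircle. w2 + u * w1 \<noteq> 0"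
    using AE_semicircle_neq[of "- w2 / w1"] by (auto elim!: eventually_mono)
  have "(\<integral>\<^sup>+u. log_quad (w2 + u * w1) \<partial>semicircle) \<le> (\<integral>\<^sup>+u. ennreal (f u) \<partial>semicircle)"
    using neq AE_semicircle_bounded
    by (intro nn_integral_mono_AE) (auto simp: log_quad_def intro!: ennreal_leI le elim!: eventually_elim2)
  also have "\<dots> = ennreal (\<integral>u. f u \<partial>semicircle)"
  proof (rule nn_integral_eq_integral[OF f])
    show "AE u in semicircle. 0 \<le> f u"
      using neq AE_semicircle_bounded
    proof eventually_elim
      case (elim u)
      then show ?case
        using le[of u] log_quad_nonneg[of "w2 + u * w1"] by linarith
    qed
  qed
  finally show ?thesis .
qed

text \<open>The average over \<open>u\<close> of the one-dimensional interaction between the projections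
  \<open>w2 + u * w1\<close> exceeds the isotropic planar interaction by at most a multiple of \<open>(cos \<theta>)\<^sup>2\<close>.
  Near the vertical axis, where \<open>v = w1 / w2\<close> is small, \<open>ln (1 + u * v)\<close> is expanded to second
  order, and the first-order term averages out because the law of \<open>u\<close> is centred. Away from the
  axis \<open>(cos \<theta>)\<^sup>2\<close> is bounded below, and it is enough that the averaged logarithm is bounded. The
  average of the quadratic parts is \<open>w2\<^sup>2 + w1\<^sup>2 / 4\<close>, at most the squared norm.\<close>

lemma semicircle_average_log_quad_le:
  obtains C :: real where "0 < C"
    and "\<And>w1 w2. (w1, w2) \<noteq> (0, 0) \<Longrightarrow>
      (\<integral>\<^sup>+u. log_quad (w2 + u * w1) \<partial>semicircle) \<le>
        ennreal ((w1\<^sup>2 + w2\<^sup>2) - ln (w1\<^sup>2 + w2\<^sup>2) / 2 + C * (w1\<^sup>2 / (w1\<^sup>2 + w2\<^sup>2)))"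
proof -
  interpret prob_space semicircle
    by (rule prob_space_semicircle)
  obtain B where B: "0 \<le> B"
      "\<And>z. (\<integral>\<^sup>+u. ennreal (max 0 (- ln \<bar>u + z\<bar>)) \<partial>semicircle) \<le> ennreal B"
    by (rule semicircle_log_potential_bounded) blast
  \<comment> \<open>Away from the axis, \<open>1 / 5 \<le> (cos \<theta>)\<^sup>2\<close> and the excess is at most \<open>2 + B\<close>; near the axis
    the excess is at most \<open>4 * (cos \<theta>)\<^sup>2\<close>.\<close>
  define C where "C = 5 * (2 + B) + 4"
  have "0 < C"
    using B(1) by (simp add: C_def)
  have quadratic: "integrable semicircle (\<lambda>u. c0 + c1 * u + c2 * u\<^sup>2)"
      "(\<integral>u. c0 + c1 * u + c2 * u\<^sup>2 \<partial>semicircle) = c0 + c2 / 4" for c0 c1 c2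
    using semicircle_mean semicircle_second_moment prob_space by simp_all
  have "(\<integral>\<^sup>+u. log_quad (w2 + u * w1) \<partial>semicircle) \<le>
      ennreal ((w1\<^sup>2 + w2\<^sup>2) - ln (w1\<^sup>2 + w2\<^sup>2) / 2 + C * (w1\<^sup>2 / (w1\<^sup>2 + w2\<^sup>2)))"
    if w: "(w1, w2) \<noteq> (0, 0)" for w1 w2
  proof -
    define N where "N = w1\<^sup>2 + w2\<^sup>2"
    have N: "0 < N"
      using w by (auto simp: N_def sum_power2_gt_zero_iff)
    show ?thesis
    proof (cases "2 * \<bar>w1\<bar> \<le> \<bar>w2\<bar>")
      case True
      then have w2: "w2 \<noteq> 0"
        using w by auto
      define v where "v = w1 / w2"
      have v: "\<bar>v\<bar> \<le> 1 / 2"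
        using True w2 by (simp add: v_def field_simps)
      have w1: "w1 = v * w2"
        using w2 by (simp add: v_def)
      define f where "f u = (5 / 2 * v\<^sup>2 - ln N / 2 + w2\<^sup>2) + (2 * w1 * w2 - v) * u + w1\<^sup>2 * u\<^sup>2" for u
      have "(w2 + u * w1)\<^sup>2 - ln \<bar>w2 + u * w1\<bar> \<le> f u" if u: "\<bar>u\<bar> < 1" for u
      proof -
        have uv: "\<bar>u * v\<bar> \<le> \<bar>v\<bar>"
          using u mult_right_mono[of "\<bar>u\<bar>" 1 "\<bar>v\<bar>"] by (simp add: abs_mult)
        with v have pos: "0 < 1 + u * v"
          by linarith
        have "w2 + u * w1 = w2 * (1 + u * v)"
          by (simp add: w1 algebra_simps)
        then have "ln \<bar>w2 + u * w1\<bar> = ln (\<bar>w2\<bar> * (1 + u * v))"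
          by (simp only: abs_mult abs_of_pos[OF pos])
        also have "\<dots> = ln \<bar>w2\<bar> + ln (1 + u * v)"
          using w2 pos by (simp add: ln_mult)
        finally have 1: "ln \<bar>w2 + u * w1\<bar> = ln \<bar>w2\<bar> + ln (1 + u * v)" .
        have "\<bar>ln (1 + u * v) - u * v\<bar> \<le> 2 * (u * v)\<^sup>2"
          using uv v by (intro abs_ln_one_plus_x_minus_x_bound) linarith
        moreover have "(u * v)\<^sup>2 \<le> v\<^sup>2"
          using uv by (simp add: abs_le_square_iff)
        ultimately have 2: "u * v - 2 * v\<^sup>2 \<le> ln (1 + u * v)"
          by linarith
        have "N = w2\<^sup>2 * (1 + v\<^sup>2)"
          by (simp add: N_def w1 power_mult_distrib distrib_left mult.commute)
        then have "ln N = 2 * ln \<bar>w2\<bar> + ln (1 + v\<^sup>2)"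
          using w2 ln_realpow[of "\<bar>w2\<bar>" 2] ln_mult_pos[of "w2\<^sup>2" "1 + v\<^sup>2"]
          by (simp add: add_pos_nonneg)
        moreover have "ln (1 + v\<^sup>2) \<le> v\<^sup>2"
          by (rule ln_add_one_self_le_self) simp
        ultimately have "ln N / 2 \<le> ln \<bar>w2\<bar> + v\<^sup>2 / 2"
          by simp
        with 1 2 show ?thesis
          by (simp add: f_def power2_sum power_mult_distrib algebra_simps)
      qed
      then have "(\<integral>\<^sup>+u. log_quad (w2 + u * w1) \<partial>semicircle) \<le> ennreal (\<integral>u. f u \<partial>semicircle)"
        unfolding f_def by (intro nn_integral_log_quad_affine_le w quadratic(1))
      also have "\<dots> \<le> ennreal (N - ln N / 2 + C * (w1\<^sup>2 / N))"
      proof (rule ennreal_leI)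
        have "v\<^sup>2 \<le> (1 / 2)\<^sup>2"
          using v by (metis abs_ge_zero power2_abs power_mono)
        then have "1 + v\<^sup>2 \<le> 5 / 4"
          by (simp add: power2_eq_square)
        then have "v\<^sup>2 * (1 + v\<^sup>2) \<le> v\<^sup>2 * (5 / 4)"
          by (rule mult_left_mono) simp
        then have "5 / 2 * v\<^sup>2 \<le> 4 * (v\<^sup>2 / (1 + v\<^sup>2))"
          by (simp add: field_simps add_pos_nonneg) (use zero_le_power2[of v] in linarith)
        also have "v\<^sup>2 / (1 + v\<^sup>2) = w1\<^sup>2 / N"
          using w2 by (simp add: N_def v_def power_divide field_simps)
        also have "4 * (w1\<^sup>2 / N) \<le> C * (w1\<^sup>2 / N)"
          using B(1) N by (intro mult_right_mono) (auto simp: C_def)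
        finally have "5 / 2 * v\<^sup>2 \<le> C * (w1\<^sup>2 / N)" .
        then show "(\<integral>u. f u \<partial>semicircle) \<le> N - ln N / 2 + C * (w1\<^sup>2 / N)"
          using zero_le_power2[of w1] N_def unfolding f_def quadratic(2) by linarith
      qed
      finally show ?thesis
        by (simp add: N_def)
    next
      case False
      then have w1: "w1 \<noteq> 0"
        by auto
      define z where "z = w2 / w1"
      define g where "g u = max 0 (- ln \<bar>u + z\<bar>)" for u
      have [measurable]: "g \<in> borel_measurable borel"
        unfolding g_def by measurable
      have g_nonneg: "0 \<le> g u" for u
        by (simp add: g_def)
      have g_le: "(\<integral>\<^sup>+u. ennreal (g u) \<partial>semicircle) \<le> ennreal B"
        using B(2)[of z] by (simp add: g_def)
      then have g: "integrable semicircle g"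
        using g_nonneg by (intro integrableI_nonneg) (auto simp: order_le_less_trans)
      have g_int: "(\<integral>u. g u \<partial>semicircle) \<le> B"
        using g_le nn_integral_eq_integral[OF g] g_nonneg B(1) by simp
      have "\<bar>w2\<bar> \<le> 2 * \<bar>w1\<bar>"
        using False by simp
      then have "w2\<^sup>2 \<le> (2 * \<bar>w1\<bar>)\<^sup>2"
        by (metis abs_ge_zero power2_abs power_mono)
      then have N_le: "N \<le> 5 * w1\<^sup>2"
        by (simp add: N_def power_mult_distrib)
      then have "ln N \<le> ln (5 * w1\<^sup>2)"
        using N w1 by simp
      also have "\<dots> = ln 5 + 2 * ln \<bar>w1\<bar>"
        using w1 ln_realpow[of "\<bar>w1\<bar>" 2] by (simp add: ln_mult)
      also have "\<dots> \<le> 4 + 2 * ln \<bar>w1\<bar>"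
        using ln_le_minus_one[of "5::real"] by simp
      finally have ln_N: "ln N / 2 - 2 \<le> ln \<bar>w1\<bar>"
        by simp
      define f where "f u = ((2 - ln N / 2 + w2\<^sup>2) + (2 * w1 * w2) * u + w1\<^sup>2 * u\<^sup>2) + g u" for u
      have "(w2 + u * w1)\<^sup>2 - ln \<bar>w2 + u * w1\<bar> \<le> f u" if u: "w2 + u * w1 \<noteq> 0" for u
      proof -
        have eq: "w2 + u * w1 = w1 * (u + z)"
          using w1 by (simp add: z_def distrib_left)
        then have "u + z \<noteq> 0"
          using u by auto
        then have "ln \<bar>w2 + u * w1\<bar> = ln \<bar>w1\<bar> + ln \<bar>u + z\<bar>"
          using w1 by (simp add: eq abs_mult ln_mult)
        moreover have "- ln \<bar>u + z\<bar> \<le> g u"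
          by (simp add: g_def)
        ultimately show ?thesis
          using ln_N by (simp add: f_def power2_sum power_mult_distrib algebra_simps)
      qed
      then have "(\<integral>\<^sup>+u. log_quad (w2 + u * w1) \<partial>semicircle) \<le> ennreal (\<integral>u. f u \<partial>semicircle)"
        unfolding f_def by (intro nn_integral_log_quad_affine_le w Bochner_Integration.integrable_add quadratic(1) g)
      also have "\<dots> \<le> ennreal (N - ln N / 2 + C * (w1\<^sup>2 / N))"
      proof (rule ennreal_leI)
        have "(\<integral>u. f u \<partial>semicircle) = (2 - ln N / 2 + w2\<^sup>2 + w1\<^sup>2 / 4) + (\<integral>u. g u \<partial>semicircle)"
          unfolding f_def using quadratic g by (subst Bochner_Integration.integral_add) auto
        moreover have "2 + B \<le> C * (w1\<^sup>2 / N)"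
        proof -
          have "1 / 5 \<le> w1\<^sup>2 / N"
            using N_le N by (simp add: field_simps)
          then have "C * (1 / 5) \<le> C * (w1\<^sup>2 / N)"
            using \<open>0 < C\<close> by (intro mult_left_mono) auto
          then show ?thesis
            by (simp add: C_def)
        qed
        ultimately show "(\<integral>u. f u \<partial>semicircle) \<le> N - ln N / 2 + C * (w1\<^sup>2 / N)"
          using g_int zero_le_power2[of w1] N_def by linarith
      qed
      finally show ?thesis
        by (simp add: N_def)
    qed
  qed
  with \<open>0 < C\<close> show thesis
    by (rule that)
qed

section \<open>Anisotropic potentials in the plane\<close>

lemma periodic_shift_int:
  fixes f :: "real \<Rightarrow> real"
  assumes per: "\<And>\<theta>. f (\<theta> + p) = f \<theta>"
  shows "f (\<theta> + of_int k * p) = f \<theta>"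
proof (induction k rule: int_induct[where k = 0])
  case (step1 i)
  then show ?case
    using per[of "\<theta> + of_int i * p"] by (simp add: algebra_simps)
next
  case (step2 i)
  then show ?case
    using per[of "\<theta> + of_int (i - 1) * p"] by (simp add: algebra_simps)
qed simp

lemma periodic_eq_of_sin_diff:
  assumes per: "\<And>\<theta>. f (\<theta> + pi) = f \<theta>" and "sin (s - t) = 0"
  shows "f s = (f t :: real)"
proof -
  obtain k :: int where "s - t = of_int k * pi"
    using assms(2) by (auto simp: sin_zero_iff_int2)
  then have "s = t + of_int k * pi"
    by simp
  then show ?thesis
    using periodic_shift_int[of f pi t k, OF per] by simp
qed

lemma angle_polar:
  assumes "x \<noteq> 0"
  shows "x /\<^sub>R norm x = (cos (angle x), sin (angle x))"
proof -
  define a b where "a = fst x / norm x" and "b = snd x / norm x"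
  have x: "x /\<^sub>R norm x = (a, b)"
    by (simp add: a_def b_def prod_eq_iff divide_inverse mult.commute)
  have "a\<^sup>2 + b\<^sup>2 = (norm x)\<^sup>2 / (norm x)\<^sup>2"
    unfolding a_def b_def power_divide add_divide_distrib[symmetric] by (simp add: norm_prod_def)
  also have "\<dots> = 1"
    using assms by simp
  finally obtain t where t: "0 \<le> t" "t < 2 * pi" "a = cos t" "b = sin t"
    by (rule sincos_total_2pi)
  have "\<exists>!\<theta>. - pi \<le> \<theta> \<and> \<theta> < pi \<and> x /\<^sub>R norm x = (cos \<theta>, sin \<theta>)"
  proof (rule ex_ex1I)
    show "\<exists>\<theta>. - pi \<le> \<theta> \<and> \<theta> < pi \<and> x /\<^sub>R norm x = (cos \<theta>, sin \<theta>)"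
    proof (cases "t < pi")
      case True
      then show ?thesis
        using t x by (intro exI[of _ t]) simp
    next
      case False
      then show ?thesis
        using t x by (intro exI[of _ "t - 2 * pi"]) (simp add: cos_diff sin_diff)
    qed
  next
    fix \<theta> \<phi>
    assume \<theta>: "- pi \<le> \<theta> \<and> \<theta> < pi \<and> x /\<^sub>R norm x = (cos \<theta>, sin \<theta>)"
      and \<phi>: "- pi \<le> \<phi> \<and> \<phi> < pi \<and> x /\<^sub>R norm x = (cos \<phi>, sin \<phi>)"
    then obtain n :: int where n: "\<theta> = \<phi> + 2 * pi * of_int n"
      using sin_cos_eq_iff[of \<theta> \<phi>] by auto
    have "2 * pi * of_int n = \<theta> - \<phi>"
      using n by simp
    also have "\<theta> - \<phi> < 2 * pi * 1"
      using \<theta> \<phi> by linarith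
    finally have upper: "2 * pi * of_int n < 2 * pi * 1" .
    have "2 * pi * (- 1) < \<theta> - \<phi>"
      using \<theta> \<phi> by linarith
    also have "\<theta> - \<phi> = 2 * pi * of_int n"
      using n by simp
    finally have lower: "2 * pi * (- 1) < 2 * pi * of_int n" .
    have "of_int n < (1::real)" "- 1 < (of_int n :: real)"
      using upper lower by (auto simp only: mult_less_cancel_left_pos[of "2 * pi"] pi_gt_zero zero_less_mult_iff zero_less_numeral simp_thms)
    then have "n = 0"
      by linarith
    with n show "\<theta> = \<phi>"
      by simp
  qed
  from theI'[OF this] show ?thesis
    unfolding angle_def by blast
qed

text \<open>A function of period \<open>pi\<close> of the angle depends on the line through \<open>x\<close> only, hence on the slope.
  In terms of the slope, unlike the polar angle, measurability in \<open>x\<close> is immediate.\<close>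

definition directional :: "(real \<Rightarrow> real) \<Rightarrow> plane \<Rightarrow> real" where
  "directional \<Omega> x = (if fst x = 0 then \<Omega> (pi / 2) else \<Omega> (arctan (snd x / fst x)))"

lemma angle_directional:
  assumes per: "\<And>\<theta>. \<Omega> (\<theta> + pi) = \<Omega> \<theta>" and x: "x \<noteq> 0"
  shows "\<Omega> (angle x) = directional \<Omega> x"
proof -
  define \<theta> where "\<theta> = angle x"
  have n: "0 < norm x"
    using x by simp
  have cs: "fst x / norm x = cos \<theta>" "snd x / norm x = sin \<theta>"
    using angle_polar[OF x] by (simp_all add: \<theta>_def prod_eq_iff divide_inverse mult.commute)
  show ?thesis
  proof (cases "fst x = 0")
    case True
    then have "sin (\<theta> - pi / 2) = 0"
      using cs by (simp add: sin_diff)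
    from periodic_eq_of_sin_diff[of \<Omega>, OF per this] show ?thesis
      using True by (simp add: directional_def \<theta>_def)
  next
    case False
    then have cos: "cos \<theta> \<noteq> 0"
      using cs n by auto
    define t where "t = arctan (snd x / fst x)"
    have "tan t = snd x / fst x"
      by (simp add: t_def tan_arctan)
    also have "\<dots> = sin \<theta> / cos \<theta>"
      using False n by (simp flip: cs)
    finally have "sin t / cos t = sin \<theta> / cos \<theta>"
      by (simp add: tan_def)
    moreover have "cos t \<noteq> 0"
      by (simp add: t_def)
    ultimately have "sin (\<theta> - t) = 0"
      using cos by (simp add: sin_diff field_simps)
    from periodic_eq_of_sin_diff[of \<Omega>, OF per this] show ?thesis
      using False by (simp add: directional_def \<theta>_def t_def)
  qed
qed

lemma borel_measurable_directional [measurable]: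
  assumes "continuous_on UNIV \<Omega>"
  shows "directional \<Omega> \<in> borel_measurable borel"
proof -
  have [measurable]: "\<Omega> \<in> borel_measurable borel"
    using assms by (rule borel_measurable_continuous_onI)
  have [measurable]: "arctan \<in> borel_measurable borel"
    by (intro borel_measurable_continuous_onI continuous_intros)
  have [measurable]: "(fst :: plane \<Rightarrow> real) \<in> borel_measurable borel" "(snd :: plane \<Rightarrow> real) \<in> borel_measurable borel"
    by (intro borel_measurable_continuous_onI continuous_intros)+
  show ?thesis
    unfolding directional_def by measurable
qed

lemma norm_plane_sq: "(norm x)\<^sup>2 = (fst x)\<^sup>2 + (snd x)\<^sup>2" for x :: plane
  by (simp add: norm_prod_def)

text \<open>Quadratic growth in the angle dominates growth in \<open>(cos \<theta>)\<^sup>2\<close>, because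
  \<open>\<bar>cos \<theta>\<bar> \<le> \<bar>\<theta> - pi / 2\<bar>\<close>.\<close>

lemma directional_lower_bound:
  assumes per: "\<And>\<theta>. \<Omega> (\<theta> + pi) = \<Omega> \<theta>" and C: "0 \<le> C"
    and lower: "\<And>\<theta>. \<theta> \<in> {0..pi} \<Longrightarrow> \<Omega> (pi / 2) + C * \<bar>\<theta> - pi / 2\<bar>\<^sup>2 \<le> \<Omega> \<theta>"
  shows "\<Omega> (pi / 2) + C * ((fst x)\<^sup>2 / ((fst x)\<^sup>2 + (snd x)\<^sup>2)) \<le> directional \<Omega> x"
proof (cases "fst x = 0")
  case False
  define t where "t = arctan (snd x / fst x)"
  have t: "- (pi / 2) < t" "t < pi / 2"
    using arctan_bounded by (auto simp: t_def)
  define \<theta> where "\<theta> = (if 0 \<le> t then t else t + pi)"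
  have \<theta>: "\<theta> \<in> {0..pi}" "\<Omega> \<theta> = \<Omega> t" "(cos \<theta>)\<^sup>2 = (cos t)\<^sup>2"
    using t per by (auto simp: \<theta>_def)
  have "(cos t)\<^sup>2 = 1 / (1 + (snd x / fst x)\<^sup>2)"
    by (simp add: t_def cos_arctan power_divide add_nonneg_nonneg)
  also have "\<dots> = (fst x)\<^sup>2 / ((fst x)\<^sup>2 + (snd x)\<^sup>2)"
    using False by (simp add: field_simps power_divide)
  finally have cos: "(fst x)\<^sup>2 / ((fst x)\<^sup>2 + (snd x)\<^sup>2) = (cos \<theta>)\<^sup>2"
    using \<theta> by simp
  have "\<bar>cos \<theta>\<bar> \<le> \<bar>\<theta> - pi / 2\<bar>"
    using abs_sin_x_le_abs_x[of "\<theta> - pi / 2"] by (simp add: sin_diff)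
  then have "(cos \<theta>)\<^sup>2 \<le> \<bar>\<theta> - pi / 2\<bar>\<^sup>2"
    by (metis abs_ge_zero power2_abs power_mono)
  then have "\<Omega> (pi / 2) + C * (cos \<theta>)\<^sup>2 \<le> \<Omega> (pi / 2) + C * \<bar>\<theta> - pi / 2\<bar>\<^sup>2"
    using C by (intro add_left_mono mult_left_mono)
  also have "\<dots> \<le> directional \<Omega> x"
    using lower[OF \<theta>(1)] \<theta>(2) False by (simp add: directional_def t_def)
  finally show ?thesis
    by (simp add: cos)
qed (simp add: directional_def)

text \<open>Positivity of \<open>- ln t + t\<^sup>2\<close> makes the interaction nonnegative whenever \<open>\<Omega>\<close> is, and then the
  extended real energy is half of an integral with values in \<^typ>\<open>ennreal\<close>.\<close>

definition pair_potential :: "(real \<Rightarrow> real) \<Rightarrow> plane \<Rightarrow> ennreal" where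
  "pair_potential \<Omega> x =
     (if x = 0 then \<infinity> else ennreal ((norm x)\<^sup>2 - ln (norm x) + directional \<Omega> x))"

definition pair_energy :: "(real \<Rightarrow> real) \<Rightarrow> plane measure \<Rightarrow> ennreal" where
  "pair_energy \<Omega> \<rho> = (\<integral>\<^sup>+x. (\<integral>\<^sup>+y. pair_potential \<Omega> (x - y) \<partial>\<rho>) \<partial>\<rho>)"

lemma borel_measurable_pair_potential [measurable]:
  assumes [measurable]: "continuous_on UNIV \<Omega>"
  shows "pair_potential \<Omega> \<in> borel_measurable borel"
  unfolding pair_potential_def by measurable

locale angular_profile =
  fixes \<Omega> :: "real \<Rightarrow> real"
  assumes cont [measurable]: "continuous_on UNIV \<Omega>"
    and nonneg: "\<And>\<theta>. 0 \<le> \<Omega> \<theta>"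
    and per: "\<And>\<theta>. \<Omega> (\<theta> + pi) = \<Omega> \<theta>"
begin

lemma directional_nonneg: "0 \<le> directional \<Omega> x"
  by (simp add: directional_def nonneg)

lemma energy_eq_pair_energy: "energy (W_log \<Omega>) \<rho> = enn2ereal (pair_energy \<Omega> \<rho>) / 2"
proof -
  have "e2ennreal (W_log \<Omega> x) = pair_potential \<Omega> x" for x
    by (simp add: W_log_def pair_potential_def angle_directional[of \<Omega>, OF per] algebra_simps)
  moreover have "e2ennreal (- W_log \<Omega> x) = 0" for x
  proof (rule e2ennreal_neg)
    have "0 \<le> - ln (norm x) + \<Omega> (angle x) + (norm x)\<^sup>2" if "x \<noteq> 0"
      using log_quad_nonneg[of "norm x"] that nonneg[of "angle x"] by simp
    then show "- W_log \<Omega> x \<le> 0"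
      by (simp add: W_log_def)
  qed
  ultimately show ?thesis
    by (simp add: energy_def pair_energy_def zero_ennreal.rep_eq)
qed

lemma is_minimizer_iff:
  "is_minimizer (W_log \<Omega>) \<rho> \<longleftrightarrow>
     \<rho> \<in> prob_measures \<and> (\<forall>\<sigma>\<in>prob_measures. pair_energy \<Omega> \<rho> \<le> pair_energy \<Omega> \<sigma>)"
proof -
  have "enn2ereal a / 2 \<le> enn2ereal b / 2 \<longleftrightarrow> a \<le> b" for a b
    unfolding less_eq_ennreal.rep_eq using enn2ereal_nonneg[of a] enn2ereal_nonneg[of b]
    by (cases "enn2ereal a" "enn2ereal b" rule: ereal2_cases) auto
  then show ?thesis
    by (simp add: is_minimizer_def energy_eq_pair_energy)
qed

end

section \<open>Minimality and uniqueness of the vertical semicircle\<close>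

lemma rho_1D_eq_distr: "rho_1D = distr semicircle borel (\<lambda>s. (0::real, s))"
proof -
  interpret prob_space semicircle
    by (rule prob_space_semicircle)
  have "return borel (0::real) \<Otimes>\<^sub>M semicircle = distr semicircle borel (\<lambda>s. (0::real, s))"
  proof (rule pair_measure_eqI)
    show "sigma_finite_measure (return borel (0::real))"
      by (intro prob_space_imp_sigma_finite prob_space_return) simp
    show "sigma_finite_measure semicircle"
      by unfold_locales
    show "sets (return borel (0::real) \<Otimes>\<^sub>M semicircle) = sets (distr semicircle borel (\<lambda>s. (0::real, s)))"
    proof -
      have "sets (return borel (0::real) \<Otimes>\<^sub>M semicircle) = sets (borel \<Otimes>\<^sub>M borel)"
        by (intro sets_pair_measure_cong sets_return sets_semicircle)
      also have "\<dots> = sets (distr semicircle borel (\<lambda>s. (0::real, s)))"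
        unfolding borel_prod by simp
      finally show ?thesis .
    qed
    fix A B assume AB: "A \<in> sets (return borel (0::real))" "B \<in> sets semicircle"
    then have "A \<times> B \<in> sets borel"
      using pair_measureI[of A borel B borel] unfolding borel_prod by simp
    then have "emeasure (distr semicircle borel (\<lambda>s. (0::real, s))) (A \<times> B) =
        emeasure semicircle ((\<lambda>s. (0::real, s)) -` (A \<times> B))"
      by (subst emeasure_distr) auto
    also have "(\<lambda>s. (0::real, s)) -` (A \<times> B) = (if 0 \<in> A then B else {})"
      by auto
    also have "emeasure semicircle \<dots> = emeasure (return borel (0::real)) A * emeasure semicircle B"
      using AB by (simp add: indicator_def)
    finally show "emeasure (return borel 0) A * emeasure semicircle B =
        emeasure (distr semicircle borel (\<lambda>s. (0::real, s))) (A \<times> B)"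
      by simp
  qed
  then show ?thesis
    by (simp add: rho_1D_def semicircle_def)
qed

lemma vertical_in_prob_measures:
  fixes a :: real
  assumes "prob_space \<nu>" and [measurable_cong]: "sets \<nu> = sets borel"
  shows "distr \<nu> borel (\<lambda>s. (a, s)) \<in> prob_measures"
proof -
  have "prob_space (distr \<nu> borel (\<lambda>s. (a, s)))"
    by (rule prob_space.prob_space_distr[OF assms(1)]) measurable
  then show ?thesis
    by (simp add: prob_measures_def)
qed

lemma rho_1D_in_prob_measures: "rho_1D \<in> prob_measures"
  unfolding rho_1D_eq_distr
  by (rule vertical_in_prob_measures[OF prob_space_semicircle]) simp

context angular_profile
begin

lemma pair_potential_vertical:
  "pair_potential \<Omega> (0, t) = log_quad t + ennreal (\<Omega> (pi / 2))"
proof (cases "t = 0")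
  case False
  then show ?thesis
    using log_quad_nonneg[OF False] nonneg[of "pi / 2"]
    by (simp add: pair_potential_def log_quad_def directional_def zero_prod_def ennreal_plus[symmetric]
             del: ennreal_plus)
qed (simp add: pair_potential_def log_quad_def zero_prod_def)

lemma pair_energy_vertical:
  assumes "prob_space \<nu>" and [measurable_cong, simp]: "sets \<nu> = sets borel"
  shows "pair_energy \<Omega> (distr \<nu> borel (\<lambda>s. (a, s))) = log_energy \<nu> + ennreal (\<Omega> (pi / 2))"
proof -
  interpret prob_space \<nu>
    by fact
  interpret V: prob_space "distr \<nu> borel (\<lambda>s. (a, s))"
    by (rule prob_space_distr) measurable
  have inner: "(\<integral>\<^sup>+t. log_quad (s - t) + ennreal (\<Omega> (pi / 2)) \<partial>\<nu>) =
      (\<integral>\<^sup>+t. log_quad (s - t) \<partial>\<nu>) + ennreal (\<Omega> (pi / 2))" for s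
    using emeasure_space_1 by (subst nn_integral_add) auto
  have "pair_energy \<Omega> (distr \<nu> borel (\<lambda>s. (a, s))) =
      (\<integral>\<^sup>+s. (\<integral>\<^sup>+y. pair_potential \<Omega> ((a, s) - y) \<partial>distr \<nu> borel (\<lambda>s. (a, s))) \<partial>\<nu>)"
    unfolding pair_energy_def by (rule nn_integral_distr) measurable
  also have "\<dots> = (\<integral>\<^sup>+s. (\<integral>\<^sup>+t. pair_potential \<Omega> ((a, s) - (a, t)) \<partial>\<nu>) \<partial>\<nu>)"
    by (intro nn_integral_cong nn_integral_distr) measurable
  also have "\<dots> = (\<integral>\<^sup>+s. (\<integral>\<^sup>+t. log_quad (s - t) \<partial>\<nu>) + ennreal (\<Omega> (pi / 2)) \<partial>\<nu>)"
    by (simp add: pair_potential_vertical inner)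
  also have "\<dots> = log_energy \<nu> + ennreal (\<Omega> (pi / 2))"
    using emeasure_space_1 unfolding log_energy_def by (subst nn_integral_add) auto
  finally show ?thesis .
qed

lemma pair_energy_rho_1D:
  "pair_energy \<Omega> rho_1D = log_energy semicircle + ennreal (\<Omega> (pi / 2))"
  unfolding rho_1D_eq_distr by (rule pair_energy_vertical[OF prob_space_semicircle]) simp

text \<open>Integrate the bound over pairs of points of a competitor \<open>\<sigma>\<close> and exchange the integrals: the left
  side becomes the average over \<open>u\<close> of the one-dimensional energies of the images of \<open>\<sigma>\<close> under the
  projections \<open>x \<mapsto> snd x + u * fst x\<close>. Each of them is at least the energy of the semicircle law.
  Up to the common constant \<open>\<Omega> (pi / 2)\<close>, this is the energy of \<^const>\<open>rho_1D\<close>, since on the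
  vertical axis all the projections agree.\<close>

lemma rho_1D_minimizes_if_projection_bound:
  assumes bound: "\<And>x. (\<integral>\<^sup>+u. log_quad (snd x + u * fst x) \<partial>semicircle) + ennreal (\<Omega> (pi / 2))
      \<le> pair_potential \<Omega> x"
  shows "is_minimizer (W_log \<Omega>) rho_1D"
  unfolding is_minimizer_iff
proof (intro conjI ballI rho_1D_in_prob_measures)
  fix \<sigma> assume \<sigma>: "\<sigma> \<in> prob_measures"
  then have [measurable_cong]: "sets \<sigma> = sets borel"
    by (simp add: prob_measures_def)
  have [measurable]: "(fst :: plane \<Rightarrow> real) \<in> borel_measurable borel" "(snd :: plane \<Rightarrow> real) \<in> borel_measurable borel"
    by (intro borel_measurable_continuous_onI continuous_intros)+
  interpret S: prob_space \<sigma>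
    using \<sigma> by (simp add: prob_measures_def)
  interpret SS: pair_prob_space \<sigma> \<sigma> ..
  interpret sc: prob_space semicircle
    by (rule prob_space_semicircle)
  interpret P: pair_prob_space "\<sigma> \<Otimes>\<^sub>M \<sigma>" semicircle ..
  define proj where "proj u x = snd x + u * fst x" for u :: real and x :: plane
  have [measurable]: "case_prod proj \<in> borel_measurable (borel \<Otimes>\<^sub>M borel)"
    unfolding proj_def by measurable
  have proj_diff: "proj u (x - y) = proj u x - proj u y" for u x y
    by (simp add: proj_def algebra_simps)
  have "log_energy semicircle + ennreal (\<Omega> (pi / 2)) =
      (\<integral>\<^sup>+u. log_energy semicircle \<partial>semicircle) + ennreal (\<Omega> (pi / 2))"
    using sc.emeasure_space_1 by simp
  also have "\<dots> \<le> (\<integral>\<^sup>+u. log_energy (distr \<sigma> borel (proj u)) \<partial>semicircle) + ennreal (\<Omega> (pi / 2))"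
  proof (intro add_right_mono nn_integral_mono semicircle_minimizes_log_energy)
    fix u :: real
    have "proj u \<in> borel_measurable \<sigma>"
      by measurable
    then show "real_distribution (distr \<sigma> borel (proj u))"
      by (rule S.real_distribution_distr)
  qed
  also have "(\<integral>\<^sup>+u. log_energy (distr \<sigma> borel (proj u)) \<partial>semicircle) =
      (\<integral>\<^sup>+u. (\<integral>\<^sup>+z. log_quad (proj u (fst z - snd z)) \<partial>(\<sigma> \<Otimes>\<^sub>M \<sigma>)) \<partial>semicircle)"
    by (intro nn_integral_cong) (simp add: S.log_energy_distr proj_diff)
  also have "\<dots> = (\<integral>\<^sup>+z. (\<integral>\<^sup>+u. log_quad (proj u (fst z - snd z)) \<partial>semicircle) \<partial>(\<sigma> \<Otimes>\<^sub>M \<sigma>))"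
    by (rule P.Fubini') measurable
  also have "\<dots> + ennreal (\<Omega> (pi / 2)) =
      (\<integral>\<^sup>+z. (\<integral>\<^sup>+u. log_quad (proj u (fst z - snd z)) \<partial>semicircle) + ennreal (\<Omega> (pi / 2)) \<partial>(\<sigma> \<Otimes>\<^sub>M \<sigma>))"
    using SS.emeasure_space_1 by (subst nn_integral_add) auto
  also have "\<dots> \<le> (\<integral>\<^sup>+z. pair_potential \<Omega> (fst z - snd z) \<partial>(\<sigma> \<Otimes>\<^sub>M \<sigma>))"
    unfolding proj_def by (intro nn_integral_mono bound)
  also have "\<dots> = pair_energy \<Omega> \<sigma>"
    unfolding pair_energy_def
    using S.nn_integral_fst[of "\<lambda>z. pair_potential \<Omega> (fst z - snd z)" \<sigma>] by simp
  finally show "pair_energy \<Omega> rho_1D \<le> pair_energy \<Omega> \<sigma>"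
    by (simp add: pair_energy_rho_1D)
qed

end

text \<open>The excess of the averaged interaction over the isotropic one is a multiple of \<open>(cos \<theta>)\<^sup>2\<close>,
  and quadratic growth of \<open>\<Omega>\<close> with a large constant pays for it.\<close>

lemma rho_1D_minimizer_of_quadratic_growth:
  obtains C :: real where "0 < C"
    and "\<And>\<Omega>. angular_profile \<Omega> \<Longrightarrow>
      (\<And>\<theta>. \<theta> \<in> {0..pi} \<Longrightarrow> \<Omega> (pi / 2) + C * \<bar>\<theta> - pi / 2\<bar>\<^sup>2 \<le> \<Omega> \<theta>) \<Longrightarrow>
      is_minimizer (W_log \<Omega>) rho_1D"
proof -
  obtain C where C: "0 < C"
    and avg: "\<And>w1 w2. (w1, w2) \<noteq> (0, 0) \<Longrightarrow>
      (\<integral>\<^sup>+u. log_quad (w2 + u * w1) \<partial>semicircle) \<le>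
        ennreal ((w1\<^sup>2 + w2\<^sup>2) - ln (w1\<^sup>2 + w2\<^sup>2) / 2 + C * (w1\<^sup>2 / (w1\<^sup>2 + w2\<^sup>2)))"
    by (rule semicircle_average_log_quad_le) blast
  show thesis
  proof (rule that[OF C])
    fix \<Omega> assume "angular_profile \<Omega>"
      and lower: "\<And>\<theta>. \<theta> \<in> {0..pi} \<Longrightarrow> \<Omega> (pi / 2) + C * \<bar>\<theta> - pi / 2\<bar>\<^sup>2 \<le> \<Omega> \<theta>"
    then interpret angular_profile \<Omega>
      by simp
    show "is_minimizer (W_log \<Omega>) rho_1D"
    proof (rule rho_1D_minimizes_if_projection_bound)
      fix x :: plane
      show "(\<integral>\<^sup>+u. log_quad (snd x + u * fst x) \<partial>semicircle) + ennreal (\<Omega> (pi / 2))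
          \<le> pair_potential \<Omega> x"
      proof (cases "x = 0")
        case False
        define N where "N = (fst x)\<^sup>2 + (snd x)\<^sup>2"
        have N: "(norm x)\<^sup>2 = N"
          by (simp add: N_def norm_plane_sq)
        have ln_N: "ln N / 2 = ln (norm x)"
          using False ln_realpow[of "norm x" 2] by (simp flip: N)
        define d where "d = C * ((fst x)\<^sup>2 / N)"
        have "0 \<le> N - ln N / 2"
          unfolding ln_N unfolding N[symmetric] using log_quad_nonneg[of "norm x"] False by simp
        moreover have "0 \<le> d"
          using C by (simp add: d_def N_def)
        ultimately have pos: "0 \<le> N - ln N / 2 + d"
          by simp
        have "(\<integral>\<^sup>+u. log_quad (snd x + u * fst x) \<partial>semicircle) \<le> ennreal (N - ln N / 2 + d)"
          using avg[of "fst x" "snd x"] False by (simp add: N_def d_def prod_eq_iff)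
        then have "(\<integral>\<^sup>+u. log_quad (snd x + u * fst x) \<partial>semicircle) + ennreal (\<Omega> (pi / 2))
            \<le> ennreal (N - ln N / 2 + d) + ennreal (\<Omega> (pi / 2))"
          by (rule add_right_mono)
        also have "\<dots> = ennreal (N - ln N / 2 + d + \<Omega> (pi / 2))"
          using pos nonneg by (simp add: ennreal_plus)
        also have "\<dots> \<le> ennreal ((norm x)\<^sup>2 - ln (norm x) + directional \<Omega> x)"
          using directional_lower_bound[of \<Omega> C x, OF per _ lower] C
          by (intro ennreal_leI) (simp add: N ln_N d_def N_def[symmetric])
        finally show ?thesis
          using False by (simp add: pair_potential_def)
      qed (simp add: pair_potential_def)
    qed
  qed
qed

lemma ennreal_le_of_add_const_le:
  assumes "a + ennreal c \<le> b + ennreal c"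
  shows "a \<le> b"
proof -
  have "ennreal c + a \<le> ennreal c + b"
    using assms by (simp only: add.commute)
  then show ?thesis
    by (simp add: ennreal_add_left_cancel_le)
qed

text \<open>The potential with \<open>g\<close> gives \<^const>\<open>rho_1D\<close> the same energy and every other measure at least as
  much energy as before. A minimizer for it therefore has no contribution from \<open>g\<close>, so almost all of
  its pairs of points differ by a vertical vector. It lives on a vertical line, where the problem is
  the one-dimensional one.\<close>

theorem unique_minimizer_of_added_anisotropy:
  assumes \<Omega>: "angular_profile \<Omega>" and g: "angular_profile g"
    and g_vertical: "g (pi / 2) = 0"
    and g_pos: "\<And>\<theta>. - (pi / 2) < \<theta> \<Longrightarrow> \<theta> < pi / 2 \<Longrightarrow> g \<theta> \<noteq> 0"
    and min: "is_minimizer (W_log \<Omega>) rho_1D"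
  shows "unique_minimizer_up_to_translation (W_log (\<lambda>\<theta>. \<Omega> \<theta> + g \<theta>)) rho_1D"
proof -
  interpret O: angular_profile \<Omega> by fact
  interpret G: angular_profile g by fact
  define \<Omega>' where "\<Omega>' \<theta> = \<Omega> \<theta> + g \<theta>" for \<theta>
  interpret A: angular_profile \<Omega>'
    unfolding \<Omega>'_def
    by unfold_locales (auto intro!: continuous_intros O.cont G.cont simp: O.nonneg G.nonneg O.per G.per)
  note [measurable] = O.cont G.cont A.cont
  define excess where "excess \<sigma> = (\<integral>\<^sup>+x. (\<integral>\<^sup>+y. ennreal (directional g (x - y)) \<partial>\<sigma>) \<partial>\<sigma>)"
    for \<sigma> :: "plane measure"
  have split: "pair_potential \<Omega>' x = pair_potential \<Omega> x + ennreal (directional g x)" for x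
  proof (cases "x = 0")
    case False
    then have "0 \<le> (norm x)\<^sup>2 - ln (norm x) + directional \<Omega> x"
      using log_quad_nonneg[of "norm x"] O.directional_nonneg[of x] by simp
    moreover have "directional \<Omega>' x = directional \<Omega> x + directional g x"
      by (simp add: directional_def \<Omega>'_def)
    ultimately show ?thesis
      using False G.directional_nonneg[of x]
      by (simp add: pair_potential_def add.assoc flip: ennreal_plus)
  qed (simp add: pair_potential_def)
  have energy_split: "pair_energy \<Omega>' \<sigma> = pair_energy \<Omega> \<sigma> + excess \<sigma>" if \<sigma>: "\<sigma> \<in> prob_measures" for \<sigma>
  proof -
    interpret prob_space \<sigma>
      using \<sigma> by (simp add: prob_measures_def)
    have [measurable_cong]: "sets \<sigma> = sets borel"
      using \<sigma> by (simp add: prob_measures_def)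
    have "pair_energy \<Omega>' \<sigma> = (\<integral>\<^sup>+x. (\<integral>\<^sup>+y. pair_potential \<Omega> (x - y) \<partial>\<sigma>)
        + (\<integral>\<^sup>+y. ennreal (directional g (x - y)) \<partial>\<sigma>) \<partial>\<sigma>)"
      unfolding pair_energy_def split by (intro nn_integral_cong nn_integral_add) measurable
    also have "\<dots> = pair_energy \<Omega> \<sigma> + excess \<sigma>"
      unfolding pair_energy_def excess_def by (intro nn_integral_add) measurable
    finally show ?thesis .
  qed
  have \<rho>_eq: "pair_energy \<Omega>' rho_1D = pair_energy \<Omega> rho_1D"
    by (simp add: A.pair_energy_rho_1D O.pair_energy_rho_1D \<Omega>'_def g_vertical)
  have min': "pair_energy \<Omega> rho_1D \<le> pair_energy \<Omega> \<sigma>" if "\<sigma> \<in> prob_measures" for \<sigma>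
    using min that by (simp add: O.is_minimizer_iff)
  have "is_minimizer (W_log \<Omega>') rho_1D"
    unfolding A.is_minimizer_iff \<rho>_eq
    using min' by (auto simp: rho_1D_in_prob_measures energy_split intro: add_increasing2)
  moreover have "\<exists>v. \<sigma> = distr rho_1D borel (\<lambda>x. x + v)" if "is_minimizer (W_log \<Omega>') \<sigma>" for \<sigma>
  proof -
    from that have \<sigma>: "\<sigma> \<in> prob_measures" and le: "pair_energy \<Omega>' \<sigma> \<le> pair_energy \<Omega>' rho_1D"
      using rho_1D_in_prob_measures by (auto simp: A.is_minimizer_iff)
    interpret prob_space \<sigma>
      using \<sigma> by (simp add: prob_measures_def)
    have sets_\<sigma> [measurable_cong]: "sets \<sigma> = sets borel"
      using \<sigma> by (simp add: prob_measures_def)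
    have "pair_energy \<Omega>' rho_1D < \<infinity>"
      using log_energy_semicircle_finite by (simp add: A.pair_energy_rho_1D)
    with le have fin: "pair_energy \<Omega> \<sigma> \<noteq> \<infinity>"
      by (auto simp: energy_split[OF \<sigma>] top_unique)
    have "pair_energy \<Omega> \<sigma> + excess \<sigma> \<le> pair_energy \<Omega> \<sigma> + 0"
      using order_trans[OF le[unfolded energy_split[OF \<sigma>] \<rho>_eq] min'[OF \<sigma>]] by (simp only: add_0_right)
    then have "excess \<sigma> = 0"
      using fin by (simp add: ennreal_add_left_cancel_le)
    then have "AE x in \<sigma>. (\<integral>\<^sup>+y. ennreal (directional g (x - y)) \<partial>\<sigma>) = 0"
      unfolding excess_def by (subst (asm) nn_integral_0_iff_AE) auto
    then obtain x0 where "(\<integral>\<^sup>+y. ennreal (directional g (x0 - y)) \<partial>\<sigma>) = 0"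
      using AE_contr by blast
    then have "AE y in \<sigma>. ennreal (directional g (x0 - y)) = 0"
      by (subst (asm) nn_integral_0_iff_AE) auto
    then have "AE y in \<sigma>. directional g (x0 - y) = 0"
    proof eventually_elim
      case (elim y)
      then show ?case
        using G.directional_nonneg[of "x0 - y"] by (simp add: ennreal_eq_0_iff)
    qed
    moreover have "fst y = fst x0" if "directional g (x0 - y) = 0" for y
      using that g_pos[OF arctan_lbound arctan_ubound] by (auto simp: directional_def split: if_splits)
    ultimately have vertical: "AE y in \<sigma>. y = (fst x0, snd y)"
      by (auto elim!: eventually_mono simp: prod_eq_iff)
    have [measurable]: "(snd :: plane \<Rightarrow> real) \<in> borel_measurable borel"
      by (intro borel_measurable_continuous_onI continuous_intros)
    define \<nu> where "\<nu> = distr \<sigma> borel snd"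
    have \<nu>: "real_distribution \<nu>"
      unfolding \<nu>_def by (rule real_distribution_distr) measurable
    then interpret nu: real_distribution \<nu> .
    have "\<sigma> = distr \<sigma> borel (\<lambda>y. y)"
      using distr_id2[OF sets_\<sigma>[symmetric]] by (simp add: id_def)
    also have "\<dots> = distr \<sigma> borel (\<lambda>y. (fst x0, snd y))"
      using vertical by (intro distr_cong_AE) auto
    also have "\<dots> = distr \<nu> borel (\<lambda>s. (fst x0, s))"
      unfolding \<nu>_def by (subst distr_distr) (auto simp: comp_def)
    finally have \<sigma>_eq: "\<sigma> = distr \<nu> borel (\<lambda>s. (fst x0, s))" .
    have "pair_energy \<Omega>' \<sigma> = log_energy \<nu> + ennreal (\<Omega>' (pi / 2))"
      by (subst \<sigma>_eq) (intro A.pair_energy_vertical nu.prob_space_axioms nu.events_eq_borel)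
    from le[unfolded this A.pair_energy_rho_1D]
    have "log_energy \<nu> \<le> log_energy semicircle"
      by (rule ennreal_le_of_add_const_le)
    then obtain c where c: "\<nu> = distr semicircle borel (\<lambda>x. x + c)"
      using semicircle_unique_log_energy_minimizer[OF \<nu> less_imp_neq[OF log_energy_semicircle_finite]]
      by blast
    have "\<sigma> = distr rho_1D borel (\<lambda>x. x + (fst x0, c))"
      unfolding \<sigma>_eq c rho_1D_eq_distr
      by (subst (1 2) distr_distr) (auto simp: comp_def)
    then show ?thesis
      by blast
  qed
  ultimately show ?thesis
    unfolding unique_minimizer_up_to_translation_def \<Omega>'_def by blast
qed

section \<open>Instability under weak anisotropy\<close>

text \<open>The points \<open>(0, s)\<close> and \<open>(t, 0)\<close> have squared distance \<open>s\<^sup>2 + t\<^sup>2\<close>, while \<open>(0, s)\<close> has from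
  \<open>(0, t)\<close> and from \<open>(0, - t)\<close> distances with product \<open>\<bar>s\<^sup>2 - t\<^sup>2\<bar>\<close>, which is smaller, and with the
  mean of their squares equal to \<open>s\<^sup>2 + t\<^sup>2\<close>.\<close>

lemma rotated_pair_cheaper:
  assumes "s \<noteq> 0" "t \<noteq> 0" "s \<noteq> t" "s \<noteq> - t"
  shows "log_quad (sqrt (s\<^sup>2 + t\<^sup>2)) + log_quad (sqrt (s\<^sup>2 + t\<^sup>2)) < log_quad (s - t) + log_quad (s + t)"
proof -
  define n where "n = sqrt (s\<^sup>2 + t\<^sup>2)"
  have n: "0 < n" "n\<^sup>2 = s\<^sup>2 + t\<^sup>2"
    using assms by (simp_all add: n_def sum_power2_gt_zero_iff)
  have pos: "0 < \<bar>s - t\<bar>" "0 < \<bar>s + t\<bar>"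
    using assms by auto
  have st: "0 < s\<^sup>2" "0 < t\<^sup>2"
    using assms by simp_all
  have "\<bar>s - t\<bar> * \<bar>s + t\<bar> = \<bar>s\<^sup>2 - t\<^sup>2\<bar>"
    by (simp add: power2_eq_square algebra_simps flip: abs_mult)
  also have "\<dots> < n\<^sup>2"
    unfolding n using st by linarith
  finally have "ln (\<bar>s - t\<bar> * \<bar>s + t\<bar>) < ln (n\<^sup>2)"
    using pos n(1) by (subst ln_less_cancel_iff) (auto intro: mult_pos_pos)
  then have ln: "ln \<bar>s - t\<bar> + ln \<bar>s + t\<bar> < 2 * ln n"
    using pos n ln_realpow[of n 2] by (simp add: ln_mult)
  have "(s - t)\<^sup>2 + (s + t)\<^sup>2 = 2 * n\<^sup>2"
    unfolding n by (simp add: power2_eq_square algebra_simps)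
  with ln have "n\<^sup>2 - ln \<bar>n\<bar> + (n\<^sup>2 - ln \<bar>n\<bar>) < (s - t)\<^sup>2 - ln \<bar>s - t\<bar> + ((s + t)\<^sup>2 - ln \<bar>s + t\<bar>)"
    using n by simp
  then show ?thesis
    using assms n log_quad_nonneg[of n] log_quad_nonneg[of "s - t"] log_quad_nonneg[of "s + t"]
    unfolding n_def[symmetric]
    by (simp add: log_quad_def add_eq_0_iff ennreal_less_iff flip: ennreal_plus)
qed

lemma distr_semicircle_uminus: "distr semicircle borel uminus = semicircle"
proof -
  have "semicircle = density (distr lborel borel uminus) (\<lambda>x. ennreal (rho_1 x))"
    by (simp add: semicircle_def lborel_distr_uminus)
  also have "\<dots> = distr (density lborel (\<lambda>x. ennreal (rho_1 (- x)))) borel uminus"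
    by (rule density_distr) measurable
  also have "\<dots> = distr semicircle borel uminus"
    by (simp add: semicircle_def rho_1_def)
  finally show ?thesis ..
qed

text \<open>By the symmetry of the semicircle law, \<open>t\<close> may be replaced by \<open>- t\<close> in its energy; average the
  two expressions and compare pointwise.\<close>

lemma isotropic_cross_energy_less:
  "(\<integral>\<^sup>+s. (\<integral>\<^sup>+t. log_quad (sqrt (s\<^sup>2 + t\<^sup>2)) \<partial>semicircle) \<partial>semicircle) < log_energy semicircle"
proof -
  interpret sc: prob_space semicircle
    by (rule prob_space_semicircle)
  interpret P: pair_prob_space semicircle semicircle ..
  let ?P = "semicircle \<Otimes>\<^sub>M semicircle"
  define V where "V z = log_quad (sqrt ((fst z)\<^sup>2 + (snd z)\<^sup>2))" for z :: "real \<times> real"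
  define L1 where "L1 z = log_quad (fst z - snd z)" for z :: "real \<times> real"
  define L2 where "L2 z = log_quad (fst z + snd z)" for z :: "real \<times> real"
  have [measurable]: "V \<in> borel_measurable ?P" "L1 \<in> borel_measurable ?P" "L2 \<in> borel_measurable ?P"
    unfolding V_def L1_def L2_def by measurable
  have V: "(\<integral>\<^sup>+s. (\<integral>\<^sup>+t. log_quad (sqrt (s\<^sup>2 + t\<^sup>2)) \<partial>semicircle) \<partial>semicircle) = (\<integral>\<^sup>+z. V z \<partial>?P)"
    by (subst sc.nn_integral_fst[symmetric], measurable) (simp add: V_def)
  have L1: "log_energy semicircle = (\<integral>\<^sup>+z. L1 z \<partial>?P)"
    by (subst sc.nn_integral_fst[symmetric], measurable) (simp add: L1_def log_energy_def)
  have "(\<integral>\<^sup>+z. L2 z \<partial>?P) = (\<integral>\<^sup>+s. (\<integral>\<^sup>+t. log_quad (s + t) \<partial>semicircle) \<partial>semicircle)"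
    by (subst sc.nn_integral_fst[symmetric], measurable) (simp add: L2_def)
  also have "\<dots> = (\<integral>\<^sup>+s. (\<integral>\<^sup>+t. log_quad (s + t) \<partial>distr semicircle borel uminus) \<partial>semicircle)"
    by (simp only: distr_semicircle_uminus)
  also have "\<dots> = log_energy semicircle"
    unfolding log_energy_def
    by (intro nn_integral_cong) (subst nn_integral_distr, auto)
  finally have L2: "log_energy semicircle = (\<integral>\<^sup>+z. L2 z \<partial>?P)" ..
  have less: "AE z in ?P. V z + V z < L1 z + L2 z"
  proof (rule P.AE_pair_measure)
    show "{z \<in> space ?P. V z + V z < L1 z + L2 z} \<in> sets ?P"
      by measurable
    show "AE s in semicircle. AE t in semicircle. V (s, t) + V (s, t) < L1 (s, t) + L2 (s, t)"
      using AE_semicircle_neq[of 0]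
    proof eventually_elim
      case (elim s)
      show ?case
        using AE_semicircle_neq[of 0] AE_semicircle_neq[of s] AE_semicircle_neq[of "- s"]
      proof eventually_elim
        case (elim t)
        then show ?case
          using \<open>s \<noteq> 0\<close> rotated_pair_cheaper[of s t] by (auto simp: V_def L1_def L2_def)
      qed
    qed
  qed
  have sum: "(\<integral>\<^sup>+z. L1 z + L2 z \<partial>?P) = log_energy semicircle + log_energy semicircle"
    using L1 L2 by (subst nn_integral_add) auto
  have le: "(\<integral>\<^sup>+z. V z + V z \<partial>?P) \<le> (\<integral>\<^sup>+z. L1 z + L2 z \<partial>?P)"
    using less by (intro nn_integral_mono_AE) (auto elim!: eventually_mono)
  have "(\<integral>\<^sup>+z. V z + V z \<partial>?P) < (\<integral>\<^sup>+z. L1 z + L2 z \<partial>?P)"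
  proof (rule nn_integral_less)
    show "(\<integral>\<^sup>+z. V z + V z \<partial>?P) \<noteq> \<infinity>"
      using le sum log_energy_semicircle_finite by (auto simp: top_unique)
    show "AE z in ?P. V z + V z \<le> L1 z + L2 z"
      using less by (auto elim!: eventually_mono)
    show "\<not> (AE z in ?P. L1 z + L2 z \<le> V z + V z)"
    proof
      assume "AE z in ?P. L1 z + L2 z \<le> V z + V z"
      with less have "AE z in ?P. False"
        by eventually_elim simp
      then show False
        using P.AE_False by simp
    qed
  qed measurable
  also note sum
  finally have "(\<integral>\<^sup>+z. V z \<partial>?P) + (\<integral>\<^sup>+z. V z \<partial>?P) < log_energy semicircle + log_energy semicircle"
    by (subst (asm) nn_integral_add) auto
  then show ?thesis
    unfolding V by (meson add_mono not_le)
qed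

text \<open>The equal mixture of \<^const>\<open>rho_1D\<close> and its copy on the horizontal axis: a fair coin selects the
  axis on which a semicircle-distributed point is placed.\<close>

definition cross_measure :: "plane measure" where
  "cross_measure = distr (semicircle \<Otimes>\<^sub>M measure_pmf (bernoulli_pmf (1 / 2))) borel
     (\<lambda>(s, b). if b then (0, s) else (s, 0))"

lemma measurable_cross [measurable]:
  "(\<lambda>(s, b). if b then (0, s) else (s, 0)) \<in>
     semicircle \<Otimes>\<^sub>M measure_pmf (bernoulli_pmf (1 / 2)) \<rightarrow>\<^sub>M (borel :: plane measure)"
  by measurable

lemma cross_measure_in_prob_measures: "cross_measure \<in> prob_measures"
proof -
  interpret pair_prob_space semicircle "measure_pmf (bernoulli_pmf (1 / 2))"
    by (intro pair_prob_space.intro pair_sigma_finite.intro prob_space_imp_sigma_finite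
        prob_space_semicircle measure_pmf.prob_space_axioms)
  have "prob_space cross_measure"
    unfolding cross_measure_def by (rule prob_space_distr) (rule measurable_cross)
  then show ?thesis
    by (simp add: prob_measures_def cross_measure_def)
qed

lemma nn_integral_cross_measure:
  assumes [measurable]: "h \<in> borel_measurable borel"
  shows "(\<integral>\<^sup>+x. h x \<partial>cross_measure) =
    ennreal (1 / 2) * (\<integral>\<^sup>+s. h (0, s) \<partial>semicircle) + ennreal (1 / 2) * (\<integral>\<^sup>+s. h (s, 0) \<partial>semicircle)"
proof -
  let ?B = "measure_pmf (bernoulli_pmf (1 / 2))"
  let ?m = "\<lambda>(s, b). if b then (0, s) else (s, 0) :: plane"
  have "(\<integral>\<^sup>+x. h x \<partial>cross_measure) = (\<integral>\<^sup>+z. h (?m z) \<partial>(semicircle \<Otimes>\<^sub>M ?B))"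
    unfolding cross_measure_def by (rule nn_integral_distr) measurable
  also have "\<dots> = (\<integral>\<^sup>+s. (\<integral>\<^sup>+b. h (?m (s, b)) \<partial>?B) \<partial>semicircle)"
    by (rule measure_pmf.nn_integral_fst[symmetric]) measurable
  also have "\<dots> = (\<integral>\<^sup>+s. ennreal (1 / 2) * h (0, s) + ennreal (1 / 2) * h (s, 0) \<partial>semicircle)"
    by (intro nn_integral_cong) (simp add: mult.commute)
  also have "\<dots> = ennreal (1 / 2) * (\<integral>\<^sup>+s. h (0, s) \<partial>semicircle) + ennreal (1 / 2) * (\<integral>\<^sup>+s. h (s, 0) \<partial>semicircle)"
    by (subst nn_integral_add) (auto simp: nn_integral_cmult)
  finally show ?thesis .
qed

interpretation isotropic: angular_profile "\<lambda>_. 0"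
  by unfold_locales auto

lemma isotropic_pair_potential: "pair_potential (\<lambda>_. 0) x = log_quad (norm x)"
  by (simp add: pair_potential_def log_quad_def directional_def)

lemma cross_measure_better_isotropic:
  "pair_energy (\<lambda>_. 0) cross_measure < pair_energy (\<lambda>_. 0) rho_1D"
proof -
  interpret sc: prob_space semicircle
    by (rule prob_space_semicircle)
  interpret X: prob_space cross_measure
    using cross_measure_in_prob_measures by (simp add: prob_measures_def)
  have [measurable_cong]: "sets cross_measure = sets borel"
    by (simp add: cross_measure_def)
  define A where "A = (\<integral>\<^sup>+s. (\<integral>\<^sup>+t. log_quad (sqrt (s\<^sup>2 + t\<^sup>2)) \<partial>semicircle) \<partial>semicircle)"
  define L where "L = log_energy semicircle"
  let ?c = "ennreal (1 / 2)"
  have "A < L"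
    unfolding A_def L_def by (rule isotropic_cross_energy_less)
  have "L < \<infinity>"
    unfolding L_def by (rule log_energy_semicircle_finite)
  have abs: "log_quad \<bar>t\<bar> = log_quad t" for t
    by (simp add: log_quad_def)
  define \<Phi> where "\<Phi> x = (\<integral>\<^sup>+y. log_quad (norm (x - y)) \<partial>cross_measure)" for x :: plane
  have [measurable]: "\<Phi> \<in> borel_measurable borel"
    unfolding \<Phi>_def by measurable
  have \<Phi>: "\<Phi> x = ?c * (\<integral>\<^sup>+t. log_quad (norm (x - (0, t))) \<partial>semicircle)
      + ?c * (\<integral>\<^sup>+t. log_quad (norm (x - (t, 0))) \<partial>semicircle)" for x
    unfolding \<Phi>_def by (rule nn_integral_cross_measure) measurable
  have "pair_energy (\<lambda>_. 0) cross_measure = (\<integral>\<^sup>+x. \<Phi> x \<partial>cross_measure)"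
    by (simp add: pair_energy_def isotropic_pair_potential \<Phi>_def)
  also have "\<dots> = ?c * (\<integral>\<^sup>+s. \<Phi> (0, s) \<partial>semicircle) + ?c * (\<integral>\<^sup>+s. \<Phi> (s, 0) \<partial>semicircle)"
    by (rule nn_integral_cross_measure) measurable
  also have "(\<integral>\<^sup>+s. \<Phi> (0, s) \<partial>semicircle) = ?c * L + ?c * A"
    unfolding \<Phi> A_def L_def log_energy_def
    by (subst nn_integral_add) (auto simp: nn_integral_cmult norm_prod_def abs add.commute)
  also have "(\<integral>\<^sup>+s. \<Phi> (s, 0) \<partial>semicircle) = ?c * A + ?c * L"
    unfolding \<Phi> A_def L_def log_energy_def
    by (subst nn_integral_add) (auto simp: nn_integral_cmult norm_prod_def abs)
  also have "?c * (?c * L + ?c * A) + ?c * (?c * A + ?c * L) < L"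
  proof -
    obtain l where l: "L = ennreal l" "0 \<le> l"
      using \<open>L < \<infinity>\<close> by (cases L) auto
    obtain a where a: "A = ennreal a" "0 \<le> a"
      using \<open>A < L\<close> \<open>L < \<infinity>\<close> by (cases A) auto
    have "a < l"
      using \<open>A < L\<close> l a by (simp add: ennreal_less_iff)
    have half: "(0::real) \<le> 1 / 2"
      by simp
    have "?c * (?c * L + ?c * A) + ?c * (?c * A + ?c * L) =
        ennreal (1 / 2 * (1 / 2 * l + 1 / 2 * a) + 1 / 2 * (1 / 2 * a + 1 / 2 * l))"
      using l a half
      by (simp only: ennreal_mult[symmetric] ennreal_plus[symmetric] mult_nonneg_nonneg add_nonneg_nonneg)
    also have "\<dots> < ennreal l"
      using \<open>a < l\<close> a(2) by (intro ennreal_lessI) (simp_all add: field_simps)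
    finally show ?thesis
      using l by simp
  qed
  also have "L = pair_energy (\<lambda>_. 0) rho_1D"
    by (simp add: L_def isotropic.pair_energy_rho_1D)
  finally show ?thesis .
qed

lemma (in angular_profile) directional_bounded:
  obtains K where "0 < K" "\<And>x. directional \<Omega> x \<le> K"
proof -
  have "compact (\<Omega> ` {- (pi / 2)..pi / 2})"
    by (intro compact_continuous_image continuous_on_subset[OF cont]) auto
  then have "bdd_above (\<Omega> ` {- (pi / 2)..pi / 2})"
    by (intro bounded_imp_bdd_above compact_imp_bounded)
  then obtain K where K: "\<forall>\<theta>\<in>{- (pi / 2)..pi / 2}. \<Omega> \<theta> \<le> K"
    by (auto simp: bdd_above_def)
  have "directional \<Omega> x \<le> max K 1" for x
    using bspec[OF K, of "pi / 2"] bspec[OF K, of "arctan (snd x / fst x)"]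
      arctan_bounded[of "snd x / fst x"]
    by (auto simp: directional_def le_max_iff_disj)
  then show thesis
    by (intro that[of "max K 1"]) auto
qed

lemma angular_profile_scale:
  "angular_profile \<omega> \<Longrightarrow> 0 \<le> \<alpha> \<Longrightarrow> angular_profile (\<lambda>\<theta>. \<alpha> * \<omega> \<theta>)"
  unfolding angular_profile_def by (auto intro!: continuous_intros)

text \<open>For \<open>\<alpha> = 0\<close> the mixture on both axes beats \<^const>\<open>rho_1D\<close> by a fixed amount \<open>l - e\<close>. The
  anisotropy costs it at most \<open>\<alpha> * K\<close> and does not change the energy of \<^const>\<open>rho_1D\<close>.\<close>

lemma rho_1D_not_minimizer_small_anisotropy:
  assumes \<omega>: "angular_profile \<omega>" and vertical: "\<omega> (pi / 2) = 0"
  obtains \<delta> where "0 < \<delta>"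
    "\<And>\<alpha>. 0 \<le> \<alpha> \<Longrightarrow> is_minimizer (W_log (\<lambda>\<theta>. \<alpha> * \<omega> \<theta>)) rho_1D \<Longrightarrow> \<delta> \<le> \<alpha>"
proof -
  interpret w: angular_profile \<omega> by fact
  obtain K where K: "0 < K" "\<And>x. directional \<omega> x \<le> K"
    by (rule w.directional_bounded) blast
  interpret X: prob_space cross_measure
    using cross_measure_in_prob_measures by (simp add: prob_measures_def)
  have [measurable_cong]: "sets cross_measure = sets borel"
    by (simp add: cross_measure_def)
  have "pair_energy (\<lambda>_. 0) rho_1D < \<infinity>"
    using log_energy_semicircle_finite by (simp add: isotropic.pair_energy_rho_1D)
  then obtain l where l: "pair_energy (\<lambda>_. 0) rho_1D = ennreal l" "0 \<le> l"
    by (cases "pair_energy (\<lambda>_. 0) rho_1D") auto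
  then obtain e where e: "pair_energy (\<lambda>_. 0) cross_measure = ennreal e" "0 \<le> e" "e < l"
    using cross_measure_better_isotropic
    by (cases "pair_energy (\<lambda>_. 0) cross_measure") (auto simp: ennreal_less_iff)
  show thesis
  proof (rule that)
    show "0 < (l - e) / K"
      using e K by simp
    fix \<alpha> :: real assume \<alpha>: "0 \<le> \<alpha>" and min: "is_minimizer (W_log (\<lambda>\<theta>. \<alpha> * \<omega> \<theta>)) rho_1D"
    interpret a: angular_profile "\<lambda>\<theta>. \<alpha> * \<omega> \<theta>"
      using \<omega> \<alpha> by (rule angular_profile_scale)
    note [measurable] = a.cont isotropic.cont
    have le: "pair_potential (\<lambda>\<theta>. \<alpha> * \<omega> \<theta>) x \<le> pair_potential (\<lambda>_. 0) x + ennreal (\<alpha> * K)" for x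
    proof (cases "x = 0")
      case False
      have "directional (\<lambda>\<theta>. \<alpha> * \<omega> \<theta>) x \<le> \<alpha> * K"
        using mult_left_mono[OF K(2)[of x] \<alpha>] by (simp add: directional_def split: if_splits)
      moreover have "0 \<le> (norm x)\<^sup>2 - ln (norm x)"
        using log_quad_nonneg[of "norm x"] False by simp
      moreover have "directional (\<lambda>_. 0) x = 0"
        by (simp add: directional_def)
      ultimately show ?thesis
        using False \<alpha> K(1) by (simp add: pair_potential_def ennreal_leI flip: ennreal_plus)
    qed (simp add: pair_potential_def)
    have "ennreal l = pair_energy (\<lambda>\<theta>. \<alpha> * \<omega> \<theta>) rho_1D"
      unfolding l(1)[symmetric] by (simp add: a.pair_energy_rho_1D isotropic.pair_energy_rho_1D vertical)
    also have "\<dots> \<le> pair_energy (\<lambda>\<theta>. \<alpha> * \<omega> \<theta>) cross_measure"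
      using min cross_measure_in_prob_measures by (simp add: a.is_minimizer_iff)
    also have "\<dots> \<le> (\<integral>\<^sup>+x. (\<integral>\<^sup>+y. pair_potential (\<lambda>_. 0) (x - y) + ennreal (\<alpha> * K) \<partial>cross_measure) \<partial>cross_measure)"
      unfolding pair_energy_def by (intro nn_integral_mono le)
    also have "\<dots> = (\<integral>\<^sup>+x. (\<integral>\<^sup>+y. pair_potential (\<lambda>_. 0) (x - y) \<partial>cross_measure) + ennreal (\<alpha> * K) \<partial>cross_measure)"
      using X.emeasure_space_1 by (intro nn_integral_cong) (subst nn_integral_add, auto)
    also have "\<dots> = pair_energy (\<lambda>_. 0) cross_measure + ennreal (\<alpha> * K)"
      unfolding pair_energy_def using X.emeasure_space_1 by (subst nn_integral_add) auto
    also have "\<dots> = ennreal (e + \<alpha> * K)"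
      using e \<alpha> K by (simp flip: ennreal_plus)
    finally have "l \<le> e + \<alpha> * K"
      using e \<alpha> K by (subst (asm) ennreal_le_iff) auto
    then show "(l - e) / K \<le> \<alpha>"
      using K by (simp add: field_simps)
  qed
qed

section \<open>The threshold\<close>

lemma smooth_circle_continuous:
  assumes "smooth_circle f"
  shows "continuous_on UNIV f"
proof -
  have "(deriv ^^ 0) f differentiable (at x)" for x
    using assms unfolding smooth_circle_def by blast
  then show ?thesis
    by (auto intro: continuous_at_imp_continuous_on differentiable_imp_continuous_within)
qed

theorem theorem7p8:
  shows "\<exists>C :: real.
    (\<forall>\<Omega> :: real \<Rightarrow> real.
       smooth_circle \<Omega> \<longrightarrow>
       (\<forall>\<theta>. \<Omega> \<theta> > 0) \<longrightarrow>
       (\<forall>\<theta>. \<Omega> (\<theta> + pi) = \<Omega> \<theta>) \<longrightarrow>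
       (\<forall>\<theta>\<in>{0..pi}. \<Omega> \<theta> \<ge> \<Omega> (pi / 2) + C * \<bar>\<theta> - pi / 2\<bar>\<^sup>2) \<longrightarrow>
       unique_minimizer_up_to_translation (W_log \<Omega>) rho_1D)
    \<and>
    (\<forall>(\<omega> :: real \<Rightarrow> real) (c :: real).
       smooth_circle \<omega> \<longrightarrow>
       (\<forall>\<theta>. \<omega> \<theta> \<ge> 0) \<longrightarrow>
       (\<exists>\<theta>. \<omega> \<theta> \<noteq> 0) \<longrightarrow>
       (\<forall>\<theta>. \<omega> (\<theta> + pi) = \<omega> \<theta>) \<longrightarrow>
       \<omega> (pi / 2) = 0 \<longrightarrow>
       c > 0 \<longrightarrow>
       (\<forall>\<theta>\<in>{0..pi}. \<omega> \<theta> \<ge> c * \<bar>\<theta> - pi / 2\<bar>\<^sup>2) \<longrightarrow>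
       (\<exists>!\<alpha>s. 0 < \<alpha>s \<and> \<alpha>s \<le> C / c \<and>
          (\<forall>\<alpha>>\<alpha>s. unique_minimizer_up_to_translation (W_log (\<lambda>\<theta>. \<alpha> * \<omega> \<theta>)) rho_1D) \<and>
          (\<forall>\<alpha>. 0 \<le> \<alpha> \<and> \<alpha> < \<alpha>s \<longrightarrow> \<not> is_minimizer (W_log (\<lambda>\<theta>. \<alpha> * \<omega> \<theta>)) rho_1D)))"
proof -
  obtain C where C: "0 < C"
    and minimizer: "\<And>\<Omega>. angular_profile \<Omega> \<Longrightarrow>
      (\<And>\<theta>. \<theta> \<in> {0..pi} \<Longrightarrow> \<Omega> (pi / 2) + C * \<bar>\<theta> - pi / 2\<bar>\<^sup>2 \<le> \<Omega> \<theta>) \<Longrightarrow>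
      is_minimizer (W_log \<Omega>) rho_1D"
    by (rule rho_1D_minimizer_of_quadratic_growth) blast
  have strict: "g \<theta> \<noteq> 0" if per: "\<And>\<theta>. g (\<theta> + pi) = g \<theta>" and "0 < c"
      and growth: "\<And>\<theta>. \<theta> \<in> {0..pi} \<Longrightarrow> c * \<bar>\<theta> - pi / 2\<bar>\<^sup>2 \<le> g \<theta>"
      and \<theta>: "- (pi / 2) < \<theta>" "\<theta> < pi / 2" for g :: "real \<Rightarrow> real" and c \<theta>
  proof -
    define t where "t = (if 0 \<le> \<theta> then \<theta> else \<theta> + pi)"
    have t: "t \<in> {0..pi}" "t \<noteq> pi / 2" "g t = g \<theta>"
      using \<theta> per by (auto simp: t_def)
    have "0 < c * \<bar>t - pi / 2\<bar>\<^sup>2"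
      using t \<open>0 < c\<close> by simp
    also have "\<dots> \<le> g \<theta>"
      using growth[OF t(1)] t(3) by simp
    finally show ?thesis
      by simp
  qed
  \<comment> \<open>Half of the growth makes \<open>rho_1D\<close> a minimizer, the other half makes it the only one.\<close>
  show ?thesis
  proof (intro exI[of _ "2 * C"] conjI allI impI)
    fix \<Omega> :: "real \<Rightarrow> real"
    assume smooth: "smooth_circle \<Omega>" and pos: "\<forall>\<theta>. \<Omega> \<theta> > 0" and per: "\<forall>\<theta>. \<Omega> (\<theta> + pi) = \<Omega> \<theta>"
      and growth: "\<forall>\<theta>\<in>{0..pi}. \<Omega> \<theta> \<ge> \<Omega> (pi / 2) + 2 * C * \<bar>\<theta> - pi / 2\<bar>\<^sup>2"
    define \<Omega>0 where "\<Omega>0 \<theta> = (\<Omega> \<theta> + \<Omega> (pi / 2)) / 2" for \<theta>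
    define g where "g \<theta> = (\<Omega> \<theta> - \<Omega> (pi / 2)) / 2" for \<theta>
    have cont: "continuous_on UNIV \<Omega>"
      using smooth by (rule smooth_circle_continuous)
    have growth': "\<Omega> (pi / 2) + 2 * (C * \<bar>\<theta> - pi / 2\<bar>\<^sup>2) \<le> \<Omega> \<theta>" if "\<theta> \<in> {0..pi}" for \<theta>
      using bspec[OF growth that] by (simp only: mult.assoc)
    have halve: "(a + a) / 2 + x \<le> (b + a) / 2" "x \<le> (b - a) / 2" if "a + 2 * x \<le> b" for a b x :: real
      using that by simp_all
    have ge: "\<Omega> (pi / 2) \<le> \<Omega> \<theta>" for \<theta>
    proof -
      define t where "t = \<theta> + of_int (- \<lfloor>\<theta> / pi\<rfloor>) * pi"
      have "t \<in> {0..pi}"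
        using floor_divide_lower[OF pi_gt_zero, of \<theta>] floor_divide_upper[OF pi_gt_zero, of \<theta>]
        by (simp add: t_def algebra_simps)
      moreover have "\<Omega> t = \<Omega> \<theta>"
        unfolding t_def using per by (intro periodic_shift_int) simp
      moreover have "0 \<le> C * \<bar>t - pi / 2\<bar>\<^sup>2"
        using C by simp
      ultimately show ?thesis
        using growth'[of t] by linarith
    qed
    have "angular_profile \<Omega>0" "angular_profile g"
      unfolding \<Omega>0_def g_def using pos per ge cont
      by (auto simp: angular_profile_def less_imp_le add_nonneg_nonneg intro!: continuous_intros)
    moreover have "is_minimizer (W_log \<Omega>0) rho_1D"
    proof (rule minimizer)
      fix \<theta> :: real assume "\<theta> \<in> {0..pi}"
      from growth'[OF this] show "\<Omega>0 (pi / 2) + C * \<bar>\<theta> - pi / 2\<bar>\<^sup>2 \<le> \<Omega>0 \<theta>"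
        unfolding \<Omega>0_def by (rule halve)
    qed fact
    moreover have "g \<theta> \<noteq> 0" if "- (pi / 2) < \<theta>" "\<theta> < pi / 2" for \<theta>
    proof (rule strict[OF _ C _ that])
      show "g (\<theta> + pi) = g \<theta>" for \<theta>
        using per by (simp add: g_def)
      fix \<theta> :: real assume "\<theta> \<in> {0..pi}"
      from growth'[OF this] show "C * \<bar>\<theta> - pi / 2\<bar>\<^sup>2 \<le> g \<theta>"
        unfolding g_def by (rule halve)
    qed
    moreover have "g (pi / 2) = 0"
      by (simp add: g_def)
    ultimately have "unique_minimizer_up_to_translation (W_log (\<lambda>\<theta>. \<Omega>0 \<theta> + g \<theta>)) rho_1D"
      by (intro unique_minimizer_of_added_anisotropy)
    moreover have "(\<lambda>\<theta>. \<Omega>0 \<theta> + g \<theta>) = \<Omega>"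
      by (auto simp: \<Omega>0_def g_def field_simps)
    ultimately show "unique_minimizer_up_to_translation (W_log \<Omega>) rho_1D"
      by simp
  next
    fix \<omega> :: "real \<Rightarrow> real" and c :: real
    assume smooth: "smooth_circle \<omega>" and nonneg: "\<forall>\<theta>. \<omega> \<theta> \<ge> 0" and per: "\<forall>\<theta>. \<omega> (\<theta> + pi) = \<omega> \<theta>"
      and vertical: "\<omega> (pi / 2) = 0" and c: "c > 0"
      and growth: "\<forall>\<theta>\<in>{0..pi}. \<omega> \<theta> \<ge> c * \<bar>\<theta> - pi / 2\<bar>\<^sup>2"
    have \<omega>: "angular_profile \<omega>"
      using smooth_circle_continuous[OF smooth] nonneg per by (simp add: angular_profile_def)
    define S where "S = {\<alpha>. 0 \<le> \<alpha> \<and> is_minimizer (W_log (\<lambda>\<theta>. \<alpha> * \<omega> \<theta>)) rho_1D}"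
    have "2 * C / c \<in> S"
    proof -
      have "C * d \<le> 2 * C / c * w" if "c * d \<le> w" "0 \<le> d" for d w
      proof -
        have "C * d \<le> 2 * C * d"
          using C that by simp
        also have "\<dots> = 2 * C / c * (c * d)"
          using c by simp
        also have "\<dots> \<le> 2 * C / c * w"
          using that C c by (intro mult_left_mono) auto
        finally show ?thesis .
      qed
      then have "is_minimizer (W_log (\<lambda>\<theta>. 2 * C / c * \<omega> \<theta>)) rho_1D"
        using growth C c by (intro minimizer angular_profile_scale[OF \<omega>]) (auto simp: vertical)
      then show ?thesis
        using C c by (simp add: S_def)
    qed
    then have S_ne: "S \<noteq> {}"
      by auto
    have S_bdd: "bdd_below S"
      by (rule bdd_belowI[of _ 0]) (simp add: S_def)
    obtain \<delta> where \<delta>: "0 < \<delta>"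
        "\<And>\<alpha>. 0 \<le> \<alpha> \<Longrightarrow> is_minimizer (W_log (\<lambda>\<theta>. \<alpha> * \<omega> \<theta>)) rho_1D \<Longrightarrow> \<delta> \<le> \<alpha>"
      by (rule rho_1D_not_minimizer_small_anisotropy[OF \<omega> vertical]) (rule that)
    have above: "unique_minimizer_up_to_translation (W_log (\<lambda>\<theta>. \<alpha> * \<omega> \<theta>)) rho_1D" if less: "Inf S < \<alpha>" for \<alpha>
    proof -
      obtain \<beta> where \<beta>: "\<beta> \<in> S" "\<beta> < \<alpha>"
        using less unfolding cInf_less_iff[OF S_ne S_bdd] by blast
      have "unique_minimizer_up_to_translation (W_log (\<lambda>\<theta>. \<beta> * \<omega> \<theta> + (\<alpha> - \<beta>) * \<omega> \<theta>)) rho_1D"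
      proof (rule unique_minimizer_of_added_anisotropy)
        show "angular_profile (\<lambda>\<theta>. \<beta> * \<omega> \<theta>)" "angular_profile (\<lambda>\<theta>. (\<alpha> - \<beta>) * \<omega> \<theta>)"
          using \<beta> by (auto simp: S_def intro!: angular_profile_scale[OF \<omega>])
        show "(\<alpha> - \<beta>) * \<omega> \<theta> \<noteq> 0" if "- (pi / 2) < \<theta>" "\<theta> < pi / 2" for \<theta>
        proof -
          have "\<omega> \<theta> \<noteq> 0"
            using per growth by (intro strict[OF _ c _ that]) blast+
          then show ?thesis
            using \<beta> by simp
        qed
        show "(\<alpha> - \<beta>) * \<omega> (pi / 2) = 0" "is_minimizer (W_log (\<lambda>\<theta>. \<beta> * \<omega> \<theta>)) rho_1D"
          using \<beta> vertical by (simp_all add: S_def)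
      qed
      moreover have "(\<lambda>\<theta>. \<beta> * \<omega> \<theta> + (\<alpha> - \<beta>) * \<omega> \<theta>) = (\<lambda>\<theta>. \<alpha> * \<omega> \<theta>)"
        by (simp add: algebra_simps)
      ultimately show ?thesis
        by simp
    qed
    define critical where "critical a \<longleftrightarrow> 0 < a \<and> a \<le> 2 * C / c \<and>
        (\<forall>\<alpha>>a. unique_minimizer_up_to_translation (W_log (\<lambda>\<theta>. \<alpha> * \<omega> \<theta>)) rho_1D) \<and>
        (\<forall>\<alpha>. 0 \<le> \<alpha> \<and> \<alpha> < a \<longrightarrow> \<not> is_minimizer (W_log (\<lambda>\<theta>. \<alpha> * \<omega> \<theta>)) rho_1D)" for a
    have "\<exists>!a. critical a"
    proof (rule ex_ex1I)
      have "\<delta> \<le> Inf S"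
        using \<delta>(2) S_ne by (intro cInf_greatest) (auto simp: S_def)
      moreover have "Inf S \<le> 2 * C / c"
        using \<open>2 * C / c \<in> S\<close> S_bdd by (rule cInf_lower)
      moreover have "\<not> is_minimizer (W_log (\<lambda>\<theta>. \<alpha> * \<omega> \<theta>)) rho_1D" if "0 \<le> \<alpha>" "\<alpha> < Inf S" for \<alpha>
        using cInf_lower[OF _ S_bdd, of \<alpha>] that by (auto simp: S_def)
      ultimately have "critical (Inf S)"
        using above \<delta>(1) by (auto simp: critical_def)
      then show "\<exists>a. critical a" ..
    next
      have le: "b \<le> a" if crit: "critical a" "critical b" for a b
      proof (rule ccontr)
        assume "\<not> b \<le> a"
        then have "a < (a + b) / 2" "(a + b) / 2 < b" "0 \<le> (a + b) / 2"
          using crit by (auto simp: critical_def)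
        with crit show False
          unfolding critical_def unique_minimizer_up_to_translation_def by blast
      qed
      show "a = b" if "critical a" "critical b" for a b
        using le[OF that] le[OF that(2,1)] by (rule antisym[rotated])
    qed
    then show "\<exists>!\<alpha>s. 0 < \<alpha>s \<and> \<alpha>s \<le> 2 * C / c \<and>
          (\<forall>\<alpha>>\<alpha>s. unique_minimizer_up_to_translation (W_log (\<lambda>\<theta>. \<alpha> * \<omega> \<theta>)) rho_1D) \<and>
          (\<forall>\<alpha>. 0 \<le> \<alpha> \<and> \<alpha> < \<alpha>s \<longrightarrow> \<not> is_minimizer (W_log (\<lambda>\<theta>. \<alpha> * \<omega> \<theta>)) rho_1D)"
      unfolding critical_def .
  qed
qed

end
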